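(* Let $q$ be a power of a prime $p$, $A=\mathbb{F}_q[T]$, and let $\mathfrak{n}$ be a non-zero ideal of $A$ that has no prime factor of degree $1$. Let $u\in A$ be any monic polynomial of degree $1$. For any non-zero ideal $\mathfrak{p}$ of $A$, let $P$ denote its monic generator. Then the modular symbol $x(u:1)$ is cuspidal, and in $\mathbb{M}(\mathfrak{n},\mathbb{Z})/p\,\mathbb{M}(\mathfrak{n},\mathbb{Z})$ we have $$\sum_{\deg\mathfrak{p}\leq1}T_\mathfrak{p}\,x(u:1)=\sum_{\deg\mathfrak{p}=1}\ \sum_{\substack{v\in A_{+\leq1}\\ v\neq u,\ v\neq P}}x(Pu:v),$$ where $A_{+\leq1}$ is the set of monic polynomials in $A$ of degree at most $1$ and $\mathfrak{p}$ runs over non-zero ideals of $A$ of the indicated degrees.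
   Context: "Ideal of $A$" means non-zero ideal; its degree is the degree of its monic generator. $K=\mathbb{F}_q(T)$, $A_+$ is the set of monic polynomials in $A$, and $\Gamma_0(\mathfrak{n})=\{\left(\begin{smallmatrix} a & b \\ c & d \end{smallmatrix}\right)\in \mathrm{GL}_2(A): c\in\mathfrak{n}\}$. For an ideal $\mathfrak{p}$, $S_\mathfrak{p}$ is the set of matrices $\left(\begin{smallmatrix} a & b \\ 0 & d \end{smallmatrix}\right)$ with $a,d\in A_+$, $(ad)=\mathfrak{p}$, $(a)+\mathfrak{n}=A$, $b\in A$, $\deg b<\deg d$. **Modular symbols.** $\mathbb{M}(\mathfrak{n},\mathbb{Z})=H_0(\Gamma_0(\mathfrak{n}),\mathrm{Div}^0(\mathbb{P}^1(K)))$ is the group of $\Gamma_0(\mathfrak{n})$-coinvariants of the degree-$0$ divisors supported on $\mathbb{P}^1(K)$ ($\mathrm{GL}_2(K)$ acting by fractional linear transformations); $[r,s]$ denotes the class of $(s)-(r)$. A modular symbol is cuspidal if it is in the kernel $\mathbb{M}_0(\mathfrak{n},\mathbb{Z})$ of the boundary map $\mathbb{M}(\mathfrak{n},\mathbb{Z})\to\mathrm{Div}^0(\Gamma_0(\mathfrak{n})\backslash\mathbb{P}^1(K))$, $[r,s]\mapsto(\Gamma_0(\mathfrak{n})s)-(\Gamma_0(\mathfrak{n})r)$; an element of $\mathbb{M}(\mathfrak{n},\mathbb{Z})/p\,\mathbb{M}(\mathfrak{n},\mathbb{Z})$ is cuspidal if it is in the kernel of the boundary map tensored with $\mathbb{F}_p$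 (equivalently, in the image of $\mathbb{M}_0(\mathfrak{n},\mathbb{Z})$). Hecke operators: $T_\mathfrak{p}[r,s]=\sum_{g\in S_\mathfrak{p}}[gr,gs]$, extended linearly and reduced modulo $p$. **Manin–Teitelbaum symbols.** $\mathbb{P}^1(A/\mathfrak{n})$ is the set of classes $(u:v)$ of pairs $(u,v)\in A\times A$ with $(u)+(v)+\mathfrak{n}=A$, where $(u_1,v_1)\sim(u_2,v_2)$ if there is $w\in A$ with $(w)+\mathfrak{n}=A$, $u_2\equiv wu_1$, $v_2\equiv wv_1\bmod\mathfrak{n}$. The map $\Gamma_0(\mathfrak{n})\left(\begin{smallmatrix} a & b \\ u & v \end{smallmatrix}\right)\mapsto(u:v)$ is a bijection $\Gamma_0(\mathfrak{n})\backslash\mathrm{GL}_2(A)\to\mathbb{P}^1(A/\mathfrak{n})$. For $(u:v)\in\mathbb{P}^1(A/\mathfrak{n})$ represented by $g=\left(\begin{smallmatrix} a & b \\ u & v \end{smallmatrix}\right)\in\mathrm{GL}_2(A)$, set $\xi(u:v)=[g(0),g(\infty)]=[b/v,a/u]\in\mathbb{M}(\mathfrak{n},\mathbb{Z})$, and let $x(u:v)$ be the image of $\xi(u:v)$ in $\mathbb{M}(\mathfrak{n},\mathbb{Z})/p\,\mathbb{M}(\mathfrak{n},\mathbb{Z})\simeq\mathbb{M}(\mathfrak{n},\mathbb{Z})\otimes_\mathbb{Z}\mathbb{F}_p$. *)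

theory Defs
  imports
    "HOL-Analysis.Determinants"
    "HOL-Algebra.Algebraic_Closure_Type"
    "HOL-Algebra.Ideal_Product"
    "HOL-Algebra.Generated_Groups"
    "HOL-Algebra.Free_Abelian_Groups"
begin

section \<open>Ideals of \<open>A = F\<^sub>q[T]\<close>\<close>

text \<open>
  The finite field is an arbitrary type \<open>'a\<close> of sort \<open>{field, finite}\<close>;
  \<open>A\<close> is the type \<open>'a poly\<close>, regarded as a ring record whenever ideals are involved,
  and \<open>K\<close> is the type \<open>'a poly fract\<close>.
\<close>

abbreviation polyring :: "'a::field poly ring" where
  "polyring \<equiv> ring_of_type_algebra"

abbreviation monic :: "'a::field poly \<Rightarrow> bool" where
  "monic f \<equiv> lead_coeff f = 1"

definition nonzero_ideal :: "'a::field poly set \<Rightarrow> bool" where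
  "nonzero_ideal I \<longleftrightarrow> ideal I polyring \<and> I \<noteq> {0}"

definition monic_generator :: "'a::field poly set \<Rightarrow> 'a poly" where
  "monic_generator I = (THE f. monic f \<and> I = PIdl\<^bsub>polyring\<^esub> f)"

definition ideal_degree :: "'a::field poly set \<Rightarrow> nat" where
  "ideal_degree I = degree (monic_generator I)"

definition prime_factor :: "'a::field poly set \<Rightarrow> 'a poly set \<Rightarrow> bool" where
  "prime_factor \<qq> \<nn> \<longleftrightarrow> primeideal \<qq> polyring \<and> nonzero_ideal \<qq> \<and>
     (\<exists>\<mm>. ideal \<mm> polyring \<and> \<nn> = ideal_prod polyring \<qq> \<mm>)"

definition coprime_to :: "'a::field poly set \<Rightarrow> 'a poly \<Rightarrow> bool" where
  "coprime_to \<nn> w \<longleftrightarrow> PIdl\<^bsub>polyring\<^esub> w <+>\<^bsub>polyring\<^esub> \<nn> = UNIV"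


section \<open>Matrices and the projective line\<close>

text \<open>\<open>P\<^sup>1(K) = K \<union> {\<infinity>}\<close>\<close>

datatype 'k projline = Fin 'k | Infty

fun moebius :: "'k::field ^ 2 ^ 2 \<Rightarrow> 'k projline \<Rightarrow> 'k projline" where
  "moebius g (Fin z) =
     (if g $ 2 $ 1 * z + g $ 2 $ 2 = 0 then Infty
      else Fin ((g $ 1 $ 1 * z + g $ 1 $ 2) / (g $ 2 $ 1 * z + g $ 2 $ 2)))"
| "moebius g Infty = (if g $ 2 $ 1 = 0 then Infty else Fin (g $ 1 $ 1 / g $ 2 $ 1))"

text \<open>The action of matrices with entries in \<open>A\<close>, through the inclusion of \<open>A\<close> into \<open>K\<close>.\<close>

definition mact :: "'a::field poly ^ 2 ^ 2 \<Rightarrow> 'a poly fract projline \<Rightarrow> 'a poly fract projline" where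
  "mact g = moebius (map_matrix to_fract g)"

definition GL2 :: "('a::field poly ^ 2 ^ 2) set" where
  "GL2 = {g. invertible g}"

definition Gamma0 :: "'a::field poly set \<Rightarrow> ('a poly ^ 2 ^ 2) set" where
  "Gamma0 \<nn> = {g \<in> GL2. g $ 2 $ 1 \<in> \<nn>}"

text \<open>
  The matrices with rows \<open>(a, b)\<close> and \<open>(0, d)\<close>. Since the library has \<open>degree 0 = 0\<close> instead of
  \<open>-\<infinity>\<close>, the case \<open>b = 0\<close> of the condition \<open>deg b < deg d\<close> is listed separately.
\<close>

definition Hecke_set :: "'a::field poly set \<Rightarrow> 'a poly set \<Rightarrow> ('a poly ^ 2 ^ 2) set" where
  "Hecke_set \<nn> \<pp> = {vector [vector [a, b], vector [0, d]] | a b d.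
     monic a \<and> monic d \<and> PIdl\<^bsub>polyring\<^esub> (a * d) = \<pp> \<and> coprime_to \<nn> a \<and>
     (b = 0 \<or> degree b < degree d)}"


section \<open>Divisors and quotient groups\<close>

text \<open>
  Divisors are elements of the library's free abelian groups. These, their subgroups and their
  quotients are group records in multiplicative notation; in particular, sums in a quotient
  are written as \<open>finprod\<close>, and multiples as powers.
\<close>

definition div_degree :: "('s \<Rightarrow>\<^sub>0 int) \<Rightarrow> int" where
  "div_degree D = (\<Sum>x\<in>Poly_Mapping.keys D. Poly_Mapping.lookup D x)"

definition Div0 :: "'s set \<Rightarrow> ('s \<Rightarrow>\<^sub>0 int) monoid" where
  "Div0 S = (free_Abelian_group S)
     \<lparr>carrier := {D \<in> carrier (free_Abelian_group S). div_degree D = 0}\<rparr>"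

definition div_act ::
  "'a::field poly ^ 2 ^ 2 \<Rightarrow> ('a poly fract projline \<Rightarrow>\<^sub>0 int) \<Rightarrow> ('a poly fract projline \<Rightarrow>\<^sub>0 int)" where
  "div_act g = frag_extend (\<lambda>r. frag_of (mact g r))"

text \<open>
  The map \<open>G/M \<rightarrow> G'/M'\<close> induced by a homomorphism \<open>f\<close> from \<open>G\<close> to \<open>G'\<close> that sends the
  subgroup \<open>M\<close> into \<open>M'\<close>; it is applied to cosets \<open>C\<close> of \<open>M\<close>.
\<close>

definition induced_map :: "('h, 'm) monoid_scheme \<Rightarrow> 'h set \<Rightarrow> ('g \<Rightarrow> 'h) \<Rightarrow> 'g set \<Rightarrow> 'h set" where
  "induced_map G' M' f C = the_elem ((\<lambda>x. M' #>\<^bsub>G'\<^esub> f x) ` C)"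

text \<open>The subgroup \<open>pG\<close> of an abelian group \<open>G\<close>, and the quotient \<open>G/pG\<close>.\<close>

definition multiples :: "nat \<Rightarrow> ('g, 'm) monoid_scheme \<Rightarrow> 'g set" where
  "multiples p G = (\<lambda>x. x [^]\<^bsub>G\<^esub> p) ` carrier G"

definition mod_p :: "nat \<Rightarrow> ('g, 'm) monoid_scheme \<Rightarrow> 'g set monoid" where
  "mod_p p G = G Mod multiples p G"


section \<open>Modular symbols\<close>

text \<open>The subgroup of \<open>Div\<^sup>0(P\<^sup>1(K))\<close> by which one divides in order to form coinvariants.\<close>

definition coinv_subgroup :: "'a::field poly set \<Rightarrow> ('a poly fract projline \<Rightarrow>\<^sub>0 int) set" where
  "coinv_subgroup \<nn> =
     generate (Div0 UNIV) {div_act g D - D | g D. g \<in> Gamma0 \<nn> \<and> D \<in> carrier (Div0 UNIV)}"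

definition MS :: "'a::field poly set \<Rightarrow> ('a poly fract projline \<Rightarrow>\<^sub>0 int) set monoid" where
  "MS \<nn> = Div0 UNIV Mod coinv_subgroup \<nn>"

text \<open>The symbol \<open>[r,s]\<close>\<close>

definition modsym ::
  "'a::field poly set \<Rightarrow> 'a poly fract projline \<Rightarrow> 'a poly fract projline \<Rightarrow>
     ('a poly fract projline \<Rightarrow>\<^sub>0 int) set" where
  "modsym \<nn> r s = coinv_subgroup \<nn> #>\<^bsub>Div0 UNIV\<^esub> (frag_of s - frag_of r)"

definition Hecke ::
  "'a::field poly set \<Rightarrow> 'a poly set \<Rightarrow>
     ('a poly fract projline \<Rightarrow>\<^sub>0 int) set \<Rightarrow> ('a poly fract projline \<Rightarrow>\<^sub>0 int) set" where
  "Hecke \<nn> \<pp> =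
     induced_map (Div0 UNIV) (coinv_subgroup \<nn>) (\<lambda>D. \<Sum>g\<in>Hecke_set \<nn> \<pp>. div_act g D)"

definition cusp :: "'a::field poly set \<Rightarrow> 'a poly fract projline \<Rightarrow> 'a poly fract projline set" where
  "cusp \<nn> r = {mact g r | g. g \<in> Gamma0 \<nn>}"

definition cusp_Div0 :: "'a::field poly set \<Rightarrow> ('a poly fract projline set \<Rightarrow>\<^sub>0 int) monoid" where
  "cusp_Div0 \<nn> = Div0 (range (cusp \<nn>))"

definition boundary ::
  "'a::field poly set \<Rightarrow> ('a poly fract projline \<Rightarrow>\<^sub>0 int) set \<Rightarrow> ('a poly fract projline set \<Rightarrow>\<^sub>0 int)" where
  "boundary \<nn> C = the_elem (frag_extend (\<lambda>r. frag_of (cusp \<nn> r)) ` C)"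

text \<open>
  Reduction modulo \<open>p\<close>. Tensoring with \<open>F\<^sub>p\<close> is written as passing to quotients by
  multiples of \<open>p\<close>.
\<close>

definition Hecke_mod ::
  "nat \<Rightarrow> 'a::field poly set \<Rightarrow> 'a poly set \<Rightarrow>
     ('a poly fract projline \<Rightarrow>\<^sub>0 int) set set \<Rightarrow> ('a poly fract projline \<Rightarrow>\<^sub>0 int) set set" where
  "Hecke_mod p \<nn> \<pp> = induced_map (MS \<nn>) (multiples p (MS \<nn>)) (Hecke \<nn> \<pp>)"

definition boundary_mod ::
  "nat \<Rightarrow> 'a::field poly set \<Rightarrow>
     ('a poly fract projline \<Rightarrow>\<^sub>0 int) set set \<Rightarrow> ('a poly fract projline set \<Rightarrow>\<^sub>0 int) set" where
  "boundary_mod p \<nn> = induced_map (cusp_Div0 \<nn>) (multiples p (cusp_Div0 \<nn>)) (boundary \<nn>)"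

definition cuspidal_mod ::
  "nat \<Rightarrow> 'a::field poly set \<Rightarrow> ('a poly fract projline \<Rightarrow>\<^sub>0 int) set set \<Rightarrow> bool" where
  "cuspidal_mod p \<nn> x \<longleftrightarrow>
     x \<in> kernel (mod_p p (MS \<nn>)) (mod_p p (cusp_Div0 \<nn>)) (boundary_mod p \<nn>)"


section \<open>Manin--Teitelbaum symbols\<close>

definition P1_pairs :: "'a::field poly set \<Rightarrow> ('a poly \<times> 'a poly) set" where
  "P1_pairs \<nn> =
     {(u, v). PIdl\<^bsub>polyring\<^esub> u <+>\<^bsub>polyring\<^esub> PIdl\<^bsub>polyring\<^esub> v <+>\<^bsub>polyring\<^esub> \<nn> = UNIV}"

definition P1_rel :: "'a::field poly set \<Rightarrow> (('a poly \<times> 'a poly) \<times> ('a poly \<times> 'a poly)) set" where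
  "P1_rel \<nn> = {((u1, v1), (u2, v2)). (u1, v1) \<in> P1_pairs \<nn> \<and> (u2, v2) \<in> P1_pairs \<nn> \<and>
     (\<exists>w. coprime_to \<nn> w \<and> u2 - w * u1 \<in> \<nn> \<and> v2 - w * v1 \<in> \<nn>)}"

text \<open>
  The symbols \<open>\<xi>(u:v)\<close> and \<open>x(u:v)\<close>. The class \<open>(u:v)\<close> may contain pairs that are not the bottom
  row of an invertible matrix, so \<open>g\<close> ranges over the matrices whose bottom row lies in the
  class; the symbol does not depend on this choice.
\<close>

definition MT_symbol ::
  "'a::field poly set \<Rightarrow> 'a poly \<Rightarrow> 'a poly \<Rightarrow> ('a poly fract projline \<Rightarrow>\<^sub>0 int) set" where
  "MT_symbol \<nn> u v = the_elem {modsym \<nn> (mact g (Fin 0)) (mact g Infty) | g.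
     g \<in> GL2 \<and> (g $ 2 $ 1, g $ 2 $ 2) \<in> P1_rel \<nn> `` {(u, v)}}"

definition MT_symbol_mod ::
  "nat \<Rightarrow> 'a::field poly set \<Rightarrow> 'a poly \<Rightarrow> 'a poly \<Rightarrow> ('a poly fract projline \<Rightarrow>\<^sub>0 int) set set" where
  "MT_symbol_mod p \<nn> u v = multiples p (MS \<nn>) #>\<^bsub>MS \<nn>\<^esub> MT_symbol \<nn> u v"

end

theory Submission imports Defs begin

text \<open>
  Let \<open>U\<close> be the image of \<open>u\<close> in \<open>K\<close>, and for \<open>d \<in> F\<^sub>q\<close> write \<open>P\<^sub>d = U + d\<close>. The symbol \<open>x(u:1)\<close> is
  \<open>[0, 1/U]\<close>, and \<open>0\<close> and \<open>1/U\<close> are the same cusp because \<open>u\<close> is prime to \<open>\<nn>\<close>. For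
  \<open>c \<noteq> d\<close> put \<open>b = 1/(d - c)\<close>. Then \<open>x(P\<^sub>d u : P\<^sub>c) = [b/P\<^sub>c, (bU + 1)/(U P\<^sub>d)]\<close> when
  \<open>c \<noteq> 0\<close>, and \<open>T\<^bsub>P\<^sub>d\<^esub> x(u:1)\<close> contains the term \<open>[b/P\<^sub>d, (bU + 1)/(U P\<^sub>d)]\<close>; the two differ by
  \<open>[b/P\<^sub>d, b/P\<^sub>c] = [1/P\<^sub>d, 1/P\<^sub>c]\<close>, and for \<open>c = 0\<close> the second term alone equals this
  difference. The sum of \<open>[1/P\<^sub>d, 1/P\<^sub>c]\<close> over all \<open>c\<close> and \<open>d\<close> vanishes by antisymmetry. The
  term of \<open>T\<^bsub>P\<^sub>d\<^esub> x(u:1)\<close> with \<open>b = 0\<close> is \<open>x(P\<^sub>d u : 1)\<close>. What remains is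
  \<open>[0, 1/U] + \<Sum>\<^sub>d [0, 1 + d/U]\<close>, which by translation and scaling equals
  \<open>q ([0, 1] + [0, 1/U])\<close>, hence is zero modulo \<open>p\<close>.
\<close>

text \<open>Without this, every \<open>$\<close> is parsed both as \<^const>\<open>vec_nth\<close> and as \<^const>\<open>fps_nth\<close>.\<close>

no_notation fps_nth (infixl "$" 75)

section \<open>Ideals of the polynomial ring\<close>

lemma polyring_simps [simp]:
  "carrier (polyring :: 'a::field poly ring) = UNIV"
  "x \<otimes>\<^bsub>polyring\<^esub> y = x * (y :: 'a poly)"
  "x \<oplus>\<^bsub>polyring\<^esub> y = x + (y :: 'a poly)"
  "\<one>\<^bsub>polyring\<^esub> = (1 :: 'a poly)"
  "\<zero>\<^bsub>polyring\<^esub> = (0 :: 'a poly)"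
  by (simp_all add: ring_of_type_algebra_def)

lemma cring_polyring: "cring (polyring :: 'a::field poly ring)"
  by (rule cring_from_type_algebra)

lemma ideal_polyring_iff:
  fixes I :: "'a::field poly set"
  shows "ideal I polyring \<longleftrightarrow>
    0 \<in> I \<and> (\<forall>a\<in>I. \<forall>b\<in>I. a + b \<in> I) \<and> (\<forall>a\<in>I. \<forall>r. r * a \<in> I)"
proof
  assume "ideal I polyring"
  then interpret ideal I "polyring :: 'a poly ring" .
  show "0 \<in> I \<and> (\<forall>a\<in>I. \<forall>b\<in>I. a + b \<in> I) \<and> (\<forall>a\<in>I. \<forall>r. r * a \<in> I)"
    using additive_subgroup.zero_closed[OF is_additive_subgroup] additive_subgroup.a_closed[OF is_additive_subgroup]
      I_l_closed by auto
next
  assume I: "0 \<in> I \<and> (\<forall>a\<in>I. \<forall>b\<in>I. a + b \<in> I) \<and> (\<forall>a\<in>I. \<forall>r. r * a \<in> I)"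
  interpret R: cring "polyring :: 'a poly ring" by (rule cring_polyring)
  have neg: "\<ominus>\<^bsub>polyring\<^esub> a = - a" for a :: "'a poly"
    by (rule R.minus_equality) auto
  have minus: "- a \<in> I" if "a \<in> I" for a
    using I that by (metis mult_minus1)
  show "ideal I polyring"
  proof (rule idealI)
    show "ring (polyring :: 'a poly ring)" by (rule R.ring_axioms)
    show "subgroup I (add_monoid polyring)"
      using I minus neg unfolding a_inv_def
      by (intro group.subgroupI[OF R.add.is_group]) auto
  qed (use I in \<open>auto simp: mult.commute\<close>)
qed

lemma PIdl_polyring: "PIdl\<^bsub>polyring\<^esub> f = {g :: 'a::field poly. f dvd g}"
  by (auto simp: cgenideal_def dvd_def mult.commute)

lemma ideal_PIdl_polyring: "ideal (PIdl\<^bsub>polyring\<^esub> (f :: 'a::field poly)) polyring"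
  using cring.cgenideal_ideal[OF cring_polyring] by simp

lemma ideal_polyring_diff:
  assumes "ideal I polyring" "a \<in> I" "b \<in> I"
  shows "a - b \<in> (I :: 'a::field poly set)"
proof -
  have "a + (- 1) * b \<in> I"
    using assms unfolding ideal_polyring_iff by blast
  then show ?thesis by simp
qed

lemma monic_dvd_unique:
  fixes f g :: "'a::field poly"
  assumes "monic f" "monic g" "f dvd g" "g dvd f"
  shows "f = g"
proof -
  obtain c where c: "g = f * c" using assms(3) by (elim dvdE)
  have "degree g \<le> degree f" "g \<noteq> 0" "f \<noteq> 0"
    using assms by (auto intro: dvd_imp_degree_le)
  with c have "degree c = 0"
    by (auto simp: degree_mult_eq)
  then obtain k where k: "c = [:k:]" by (auto elim: degree_eq_zeroE)
  have "lead_coeff g = lead_coeff f * lead_coeff c"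
    unfolding c by (rule lead_coeff_mult)
  with assms k have "c = 1" by (simp add: one_pCons)
  with c show ?thesis by simp
qed

lemma monic_generator_PIdl [simp]:
  fixes f :: "'a::field poly"
  assumes "monic f"
  shows "monic_generator (PIdl\<^bsub>polyring\<^esub> f) = f"
  unfolding monic_generator_def
proof (rule the_equality)
  fix g :: "'a poly"
  assume g: "monic g \<and> PIdl\<^bsub>polyring\<^esub> f = PIdl\<^bsub>polyring\<^esub> g"
  then have "g dvd x \<longleftrightarrow> f dvd x" for x unfolding PIdl_polyring by (metis mem_Collect_eq)
  then have "g dvd f" "f dvd g" using dvd_refl by metis+
  then show "g = f" using g assms monic_dvd_unique by blast
qed (use assms in auto)

text \<open>An element of least degree, scaled to be monic, generates: the remainder of any other
  element modulo it lies in the ideal and has smaller degree, hence is zero.\<close>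

lemma ideal_polyring_principal:
  fixes I :: "'a::field poly set"
  assumes "ideal I polyring" "I \<noteq> {0}"
  obtains f where "monic f" "I = PIdl\<^bsub>polyring\<^esub> f"
proof -
  have I: "0 \<in> I" "\<And>a b. a \<in> I \<Longrightarrow> b \<in> I \<Longrightarrow> a + b \<in> I" "\<And>a r. a \<in> I \<Longrightarrow> r * a \<in> I"
    using assms(1) by (auto simp: ideal_polyring_iff)
  obtain x where "x \<in> I \<and> x \<noteq> 0" using assms(2) I(1) by blast
  then obtain g where g: "g \<in> I" "g \<noteq> 0" "\<And>y. y \<in> I \<Longrightarrow> y \<noteq> 0 \<Longrightarrow> degree g \<le> degree y"
    using ex_has_least_nat[of "\<lambda>x. x \<in> I \<and> x \<noteq> 0" x degree] by blast
  define f where "f = smult (inverse (lead_coeff g)) g"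
  have f: "f \<in> I" "monic f" "degree f = degree g" "f \<noteq> 0"
    using g(2) I(3)[OF g(1), of "[:inverse (lead_coeff g):]"] by (auto simp: f_def)
  have "I = PIdl\<^bsub>polyring\<^esub> f"
  proof (intro Set.set_eqI iffI)
    fix h assume h: "h \<in> I"
    have "h mod f = h - (h div f) * f" by (simp add: minus_div_mult_eq_mod)
    then have "h mod f \<in> I"
      using ideal_polyring_diff[OF assms(1) h I(3)[OF f(1)]] by simp
    then have "h mod f = 0"
      using g(3)[of "h mod f"] f degree_mod_less[of f h] by fastforce
    then show "h \<in> PIdl\<^bsub>polyring\<^esub> f" unfolding PIdl_polyring by auto
  next
    fix h assume "h \<in> PIdl\<^bsub>polyring\<^esub> f"
    then show "h \<in> I" unfolding PIdl_polyring dvd_def using I(3)[OF f(1)] by (auto simp: mult.commute)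
  qed
  with f(2) that show ?thesis by blast
qed

lemma nonzero_ideal_PIdl: "monic f \<Longrightarrow> nonzero_ideal (PIdl\<^bsub>polyring\<^esub> (f :: 'a::field poly))"
  using ideal_PIdl_polyring[of f] dvd_refl[of f] unfolding nonzero_ideal_def PIdl_polyring
  by (metis leading_coeff_0_iff mem_Collect_eq singletonD zero_neq_one)

text \<open>Turns the index sets of the sums over ideals into sets of monic polynomials, which can
  be parametrised explicitly.\<close>

lemma nonzero_ideals_eq_image:
  "{I :: 'a::field poly set. nonzero_ideal I \<and> Q (ideal_degree I)} =
     (\<lambda>f. PIdl\<^bsub>polyring\<^esub> f) ` {f. monic f \<and> Q (degree f)}"
proof (intro Set.set_eqI iffI)
  fix I :: "'a poly set"
  assume I: "I \<in> {I. nonzero_ideal I \<and> Q (ideal_degree I)}"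
  then obtain f where "monic f" "I = PIdl\<^bsub>polyring\<^esub> f"
    using ideal_polyring_principal unfolding nonzero_ideal_def by blast
  with I show "I \<in> (\<lambda>f. PIdl\<^bsub>polyring\<^esub> f) ` {f. monic f \<and> Q (degree f)}"
    by (auto simp: ideal_degree_def)
qed (auto simp: nonzero_ideal_PIdl ideal_degree_def)

lemma add_ideal_eq_UNIV_iff:
  fixes I J :: "'a::field poly set"
  assumes "ideal I polyring" "ideal J polyring"
  shows "I <+>\<^bsub>polyring\<^esub> J = UNIV \<longleftrightarrow> (\<exists>i\<in>I. 1 - i \<in> J)"
proof
  assume "I <+>\<^bsub>polyring\<^esub> J = UNIV"
  then have "1 \<in> I <+>\<^bsub>polyring\<^esub> J" by blast
  then obtain i j where "i \<in> I" "j \<in> J" "1 = i + j" by (auto simp: set_add_def set_mult_def)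
  then have "1 - i = j" by (metis add_diff_cancel_left')
  with \<open>i \<in> I\<close> \<open>j \<in> J\<close> show "\<exists>i\<in>I. 1 - i \<in> J" by blast
next
  assume "\<exists>i\<in>I. 1 - i \<in> J"
  then obtain i where i: "i \<in> I" "1 - i \<in> J" by blast
  have "x \<in> I <+>\<^bsub>polyring\<^esub> J" for x
  proof -
    have "x * i \<in> I" "x * (1 - i) \<in> J" using i assms unfolding ideal_polyring_iff by blast+
    moreover have "x = x * i + x * (1 - i)" by (simp add: algebra_simps)
    ultimately show ?thesis by (force simp: set_add_def set_mult_def)
  qed
  then show "I <+>\<^bsub>polyring\<^esub> J = UNIV" by blast
qed

text \<open>A decomposition of 1 exhibits an inverse of \<open>w\<close> modulo \<nn>. Coprimality
  is used in this form from here on.\<close>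

lemma coprime_to_iff:
  assumes "ideal \<nn> polyring"
  shows "coprime_to \<nn> w \<longleftrightarrow> (\<exists>a. 1 - a * w \<in> \<nn>)"
  unfolding coprime_to_def add_ideal_eq_UNIV_iff[OF ideal_PIdl_polyring assms]
  by (auto simp: PIdl_polyring dvd_def mult.commute)

lemma coprime_to_dvd:
  assumes "ideal \<nn> polyring" "coprime_to \<nn> w" "v dvd w"
  shows "coprime_to \<nn> v"
proof -
  obtain a where a: "1 - a * w \<in> \<nn>" using assms coprime_to_iff by blast
  obtain b where "w = v * b" using assms(3) by (elim dvdE)
  with a have "1 - (a * b) * v \<in> \<nn>" by (simp add: mult_ac)
  then show ?thesis using assms(1) coprime_to_iff by blast
qed

lemma coprime_to_cancel:
  assumes "ideal \<nn> polyring" "coprime_to \<nn> w" "w * x \<in> \<nn>"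
  shows "x \<in> \<nn>"
proof -
  obtain a where "1 - a * w \<in> \<nn>" using assms coprime_to_iff by blast
  then have "x * (1 - a * w) + a * (w * x) \<in> \<nn>"
    using assms(1,3) unfolding ideal_polyring_iff by blast
  then show ?thesis by (simp add: algebra_simps)
qed

lemma coprime_to_1: "ideal \<nn> polyring \<Longrightarrow> coprime_to \<nn> 1"
  using coprime_to_iff[of \<nn> 1] ideal_polyring_iff[of \<nn>] by (metis diff_self mult_1)

text \<open>A linear \<open>P\<close> that is not a unit modulo \<nn> would divide every element of
  \<nn>, and the ideal it generates would be a prime factor of degree 1.\<close>

lemma coprime_to_degree_1:
  fixes \<nn> :: "'a::field poly set" and P :: "'a poly"
  assumes n: "ideal \<nn> polyring" and "\<nexists>\<qq>. prime_factor \<qq> \<nn> \<and> ideal_degree \<qq> = 1"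
    and P: "monic P" "degree P = 1"
  shows "coprime_to \<nn> P"
proof (rule ccontr)
  assume nc: "\<not> coprime_to \<nn> P"
  \<comment> \<open>A remainder modulo \<open>P\<close> is a constant; if it were nonzero, dividing
    by it would make \<open>P\<close> invertible modulo \<nn>.\<close>
  have dvd: "P dvd f" if "f \<in> \<nn>" for f
  proof (rule ccontr)
    assume "\<not> P dvd f"
    then have 0: "f mod P \<noteq> 0" by auto
    then have "degree (f mod P) = 0" using degree_mod_less[of P f] P by fastforce
    then obtain k where k: "f mod P = [:k:]" by (auto elim: degree_eq_zeroE)
    with 0 have k0: "k \<noteq> 0" by auto
    have "[:inverse k:] * f \<in> \<nn>" using that n unfolding ideal_polyring_iff by blast
    moreover have "[:inverse k:] * f = [:inverse k:] * (f div P * P + [:k:])"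
      using div_mult_mod_eq[of f P] k by simp
    moreover have "\<dots> = 1 - (- [:inverse k:] * (f div P)) * P"
      using k0 by (simp add: algebra_simps one_pCons)
    ultimately show False using nc coprime_to_iff[OF n] by metis
  qed
  have "prime_elem P"
    using P(2) prime_elem_linear_field_poly by (metis degree1_coeffs)
  then have "primeideal (PIdl\<^bsub>polyring\<^esub> P) polyring"
  proof (intro primeidealI ideal_PIdl_polyring cring_polyring)
    assume P: "prime_elem P"
    have "1 \<notin> PIdl\<^bsub>polyring\<^esub> P"
      using prime_elem_not_unit[OF P] by (simp add: PIdl_polyring)
    then show "carrier polyring \<noteq> PIdl\<^bsub>polyring\<^esub> P" by (metis UNIV_I polyring_simps(1))
  qed (simp add: PIdl_polyring prime_elem_dvd_mult_iff)
  \<comment> \<open>The complementary factor is the quotient ideal of \<nn> by \<open>P\<close>; one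
    inclusion uses that \<open>P\<close> divides every element of \<nn>.\<close>
  moreover have "\<nn> = ideal_prod polyring (PIdl\<^bsub>polyring\<^esub> P) {x. P * x \<in> \<nn>}"
  proof (intro Set.set_eqI iffI)
    fix f assume "f \<in> \<nn>"
    then obtain g where "f = P * g" using dvd by (auto elim: dvdE)
    with \<open>f \<in> \<nn>\<close> show "f \<in> ideal_prod polyring (PIdl\<^bsub>polyring\<^esub> P) {x. P * x \<in> \<nn>}"
      using ideal_prod.prod[of P "PIdl\<^bsub>polyring\<^esub> P" g "{x. P * x \<in> \<nn>}" polyring]
      by (simp add: PIdl_polyring)
  next
    fix f assume "f \<in> ideal_prod polyring (PIdl\<^bsub>polyring\<^esub> P) {x. P * x \<in> \<nn>}"
    then show "f \<in> \<nn>"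
    proof induction
      case (prod i j)
      then obtain c where c: "i = P * c" by (auto simp: PIdl_polyring elim!: dvdE)
      have "c * (P * j) \<in> \<nn>" using prod n unfolding ideal_polyring_iff by blast
      then show ?case using c by (simp add: mult_ac)
    qed (use n in \<open>auto simp: ideal_polyring_iff\<close>)
  qed
  moreover have "ideal {x. P * x \<in> \<nn>} polyring"
    using n unfolding ideal_polyring_iff by (simp add: distrib_left mult.left_commute[of P])
  ultimately have "prime_factor (PIdl\<^bsub>polyring\<^esub> P) \<nn>"
    using P nonzero_ideal_PIdl unfolding prime_factor_def by blast
  moreover have "ideal_degree (PIdl\<^bsub>polyring\<^esub> P) = 1"
    using P by (simp add: ideal_degree_def)
  ultimately show False using assms(2) by blast
qed

section \<open>Matrices over the polynomial ring\<close>

abbreviation mat2 :: "'b \<Rightarrow> 'b \<Rightarrow> 'b \<Rightarrow> 'b \<Rightarrow> 'b::zero ^ 2 ^ 2" where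
  "mat2 a b c d \<equiv> vector [vector [a, b], vector [c, d]]"

lemma mat2_eq_iff: "g = h \<longleftrightarrow> g $ 1 $ 1 = h $ 1 $ 1 \<and> g $ 1 $ 2 = h $ 1 $ 2 \<and>
    g $ 2 $ 1 = h $ 2 $ 1 \<and> g $ 2 $ 2 = h $ 2 $ (2::2)" for g h :: "'b ^ 2 ^ 2"
proof -
  have "g = h \<longleftrightarrow> (\<forall>i j. g $ i $ j = h $ i $ j)" by (simp only: vec_eq_iff)
  then show ?thesis by (simp only: forall_2) blast
qed

lemma matrix_mult_2:
  "(g ** h) $ i $ j = g $ i $ 1 * h $ 1 $ j + g $ i $ 2 * h $ 2 $ j"
  for g h :: "'b::semiring_1 ^ 2 ^ 2"
  by (simp add: matrix_matrix_mult_def sum_2)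

lemma GL2_iff: "g \<in> GL2 \<longleftrightarrow> det g dvd 1"
  for g :: "'a::field poly ^ 2 ^ 2"
proof
  assume "g \<in> GL2"
  then obtain h where "g ** h = mat 1" by (auto simp: GL2_def invertible_def)
  then have "det g * det h = 1" by (metis det_mul det_I)
  then show "det g dvd 1" by (metis dvd_triv_left)
next
  assume "det g dvd 1"
  then obtain e where e: "det g * e = 1" by (metis dvdE)
  \<comment> \<open>The adjugate divided by the determinant, \<open>e\<close> being the inverse of
    \<open>det g\<close>.\<close>
  define h where "h = mat2 (e * g $ 2 $ 2) (- e * g $ 1 $ 2) (- e * g $ 2 $ 1) (e * g $ 1 $ 1)"
  have e': "(g $ 1 $ 1 * g $ 2 $ 2 - g $ 1 $ 2 * g $ 2 $ 1) * e = 1"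
    using e by (simp add: det_2)
  have "g ** h = mat 1" "h ** g = mat 1"
    using e' by (auto simp: mat2_eq_iff matrix_mult_2 h_def mat_def algebra_simps)
  then show "g \<in> GL2" by (auto simp: GL2_def invertible_def)
qed

lemma GL2_det_nonzero: "g \<in> GL2 \<Longrightarrow> det g \<noteq> 0"
  by (auto simp: GL2_iff)

section \<open>The action on the projective line in homogeneous coordinates\<close>

definition projpt :: "'k::field \<Rightarrow> 'k \<Rightarrow> 'k projline" where
  "projpt v w = (if w = 0 then Infty else Fin (v / w))"

text \<open>In homogeneous coordinates the action is linear, so composing needs no case distinction
  on poles. The hypothesis excludes the pair \<open>(0, 0)\<close>, to which \<open>projpt\<close>
  gives the default value \<open>Infty\<close>.\<close>

lemma moebius_projpt:
  assumes "v \<noteq> 0 \<or> w \<noteq> 0"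
  shows "moebius g (projpt v w) =
    projpt (g $ 1 $ 1 * v + g $ 1 $ 2 * w) (g $ 2 $ 1 * v + g $ 2 $ 2 * w)"
proof (cases "w = 0")
  case True
  with assms show ?thesis by (simp add: projpt_def)
next
  case False
  have "g $ i $ 1 * (v / w) + g $ i $ 2 = (g $ i $ 1 * v + g $ i $ 2 * w) / w" for i
    using False by (simp add: field_simps)
  with False show ?thesis by (simp add: projpt_def)
qed

lemma moebius_conv_projpt:
  "moebius g (Fin z) = projpt (g $ 1 $ 1 * z + g $ 1 $ 2) (g $ 2 $ 1 * z + g $ 2 $ 2)"
  "moebius g Infty = projpt (g $ 1 $ 1) (g $ 2 $ 1)"
  by (simp_all add: projpt_def)

lemma moebius_mult:
  assumes "det h \<noteq> 0"
  shows "moebius (g ** h) r = moebius g (moebius h r)"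
proof (cases r)
  case (Fin z)
  \<comment> \<open>A nonzero determinant keeps the two coordinates of the image point from
    vanishing together.\<close>
  have "h $ 1 $ 1 * (h $ 2 $ 1 * z + h $ 2 $ 2) - h $ 2 $ 1 * (h $ 1 $ 1 * z + h $ 1 $ 2) = det h"
    by (simp add: det_2 algebra_simps)
  with assms have nz: "h $ 1 $ 1 * z + h $ 1 $ 2 \<noteq> 0 \<or> h $ 2 $ 1 * z + h $ 2 $ 2 \<noteq> 0"
    by auto
  show ?thesis
    unfolding Fin moebius_conv_projpt moebius_projpt[OF nz] matrix_mult_2
    by (simp add: algebra_simps)
next
  case Infty
  from assms have nz: "h $ 1 $ 1 \<noteq> 0 \<or> h $ 2 $ 1 \<noteq> 0"
    by (auto simp: det_2)
  show ?thesis
    unfolding Infty moebius_conv_projpt moebius_projpt[OF nz] matrix_mult_2 by simp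
qed

lemma map_matrix_to_fract_mult:
  "map_matrix to_fract (g ** h) = map_matrix to_fract g ** map_matrix to_fract h"
  for g h :: "'b::idom ^ 2 ^ 2"
  by (simp add: mat2_eq_iff matrix_mult_2)

lemma det_map_matrix_to_fract: "det (map_matrix to_fract g) = to_fract (det (g :: 'b::idom ^ 2 ^ 2))"
  by (simp add: det_2)

lemma mact_mult: "det h \<noteq> 0 \<Longrightarrow> mact (g ** h) r = mact g (mact h r)"
  unfolding mact_def map_matrix_to_fract_mult
  by (rule moebius_mult) (simp add: det_map_matrix_to_fract)

section \<open>The congruence subgroup and its cosets in the general linear group\<close>

lemma Gamma0_iff: "g \<in> Gamma0 \<nn> \<longleftrightarrow> det g dvd 1 \<and> g $ 2 $ 1 \<in> \<nn>"
  by (simp add: Gamma0_def GL2_iff)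

lemma Gamma0_mult:
  assumes "ideal \<nn> polyring" "g \<in> Gamma0 \<nn>" "h \<in> Gamma0 \<nn>"
  shows "g ** h \<in> Gamma0 \<nn>"
proof -
  have "h $ 1 $ 1 * g $ 2 $ 1 + g $ 2 $ 2 * h $ 2 $ 1 \<in> \<nn>"
    using assms unfolding Gamma0_iff ideal_polyring_iff by blast
  moreover have "det (g ** h) dvd 1"
    using assms unfolding Gamma0_iff det_mul by auto
  ultimately show ?thesis by (simp add: Gamma0_iff matrix_mult_2 mult.commute)
qed

text \<open>The lower left entry of \<open>g\<close> times the inverse of \<open>h\<close> is the
  minor of the two bottom rows divided by \<open>det h\<close>. This serves both the independence of
  Manin-Teitelbaum symbols of the chosen matrix and the invariance of cusps.\<close>

lemma Gamma0_solve:
  assumes n: "ideal \<nn> polyring" and "g \<in> GL2" "h \<in> GL2"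
    and "g $ 2 $ 1 * h $ 2 $ 2 - g $ 2 $ 2 * h $ 2 $ 1 \<in> \<nn>"
  obtains \<gamma> where "\<gamma> \<in> Gamma0 \<nn>" "g = \<gamma> ** h"
proof -
  obtain e where e: "det h * e = 1" using assms(3) GL2_iff by (metis dvdE)
  define k where "k = mat2 (e * h $ 2 $ 2) (- e * h $ 1 $ 2) (- e * h $ 2 $ 1) (e * h $ 1 $ 1)"
  have kh: "k ** h = mat 1"
    using e by (auto simp: mat2_eq_iff matrix_mult_2 k_def mat_def det_2 algebra_simps)
  then have k: "det k * det h = 1" by (metis det_mul det_I)
  have "e * (g $ 2 $ 1 * h $ 2 $ 2 - g $ 2 $ 2 * h $ 2 $ 1) \<in> \<nn>"
    using n assms(4) unfolding ideal_polyring_iff by blast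
  then have "(g ** k) $ 2 $ 1 \<in> \<nn>"
    by (simp add: matrix_mult_2 k_def algebra_simps)
  moreover have "det k dvd 1" using k by (metis dvd_triv_left)
  then have "det (g ** k) dvd 1"
    using assms(2) by (simp add: det_mul GL2_iff is_unit_mult_iff)
  ultimately have "g ** k \<in> Gamma0 \<nn>" by (simp add: Gamma0_iff)
  moreover have "g = (g ** k) ** h"
    by (simp add: kh flip: matrix_mul_assoc)
  ultimately show ?thesis using that by blast
qed

lemma unit_poly_obtain:
  fixes x :: "'a::field poly"
  assumes "x dvd 1"
  obtains k where "k \<noteq> 0" "x = [:k:]"
proof -
  from assms obtain k where "x = [:k:]" "k dvd 1" unfolding is_unit_poly_iff by blast
  then have "k \<noteq> 0" by (metis dvd_0_left zero_neq_one)
  then show ?thesis using \<open>x = [:k:]\<close> that by blast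
qed

section \<open>Hecke representatives as Hermite normal forms\<close>

lemma Hecke_setI:
  assumes "monic a" "monic d" "coprime_to \<nn> a" "b = 0 \<or> degree b < degree d"
  shows "mat2 a b 0 d \<in> Hecke_set \<nn> (PIdl\<^bsub>polyring\<^esub> (a * d))"
  using assms unfolding Hecke_set_def by blast

text \<open>A matrix \<gamma> linking two normal forms is upper triangular with constant diagonal.
  Monicity makes the diagonal entries 1, and the degree bounds make the remaining entry 0.\<close>

lemma Hecke_set_unique:
  assumes "g \<in> Hecke_set \<nn> \<pp>" "g' \<in> Hecke_set \<nn> \<pp>" "\<gamma> \<in> GL2" "\<gamma> ** g = g'"
  shows "g = g'"
proof -
  obtain a b d where g: "g = mat2 a b 0 d" "monic a" "monic d" "b = 0 \<or> degree b < degree d"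
    using assms(1) by (auto simp: Hecke_set_def)
  obtain a' b' d' where g': "g' = mat2 a' b' 0 d'" "monic a'" "monic d'" "b' = 0 \<or> degree b' < degree d'"
    using assms(2) by (auto simp: Hecke_set_def)
  have eq: "a' = \<gamma> $ 1 $ 1 * a" "b' = \<gamma> $ 1 $ 1 * b + \<gamma> $ 1 $ 2 * d" "0 = \<gamma> $ 2 $ 1 * a"
    "d' = \<gamma> $ 2 $ 1 * b + \<gamma> $ 2 $ 2 * d"
    using assms(4) unfolding g(1) g'(1) by (simp_all add: mat2_eq_iff matrix_mult_2)
  from g(2) have "a \<noteq> 0" by auto
  with eq(3) have z: "\<gamma> $ 2 $ 1 = 0" by simp
  have "\<gamma> $ 1 $ 1 * \<gamma> $ 2 $ 2 dvd 1"
    using assms(3) z by (simp add: GL2_iff det_2)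
  then have "\<gamma> $ 1 $ 1 dvd 1" "\<gamma> $ 2 $ 2 dvd 1" by (simp_all add: is_unit_mult_iff)
  then obtain k l where k: "\<gamma> $ 1 $ 1 = [:k:]" and l: "\<gamma> $ 2 $ 2 = [:l:]"
    using unit_poly_obtain by metis
  have "k = 1" using eq(1) g(2) g'(2) unfolding k by (cases "k = 0") simp_all
  have "l = 1" using eq(4) g(3) g'(3) unfolding l z by (cases "l = 0") simp_all
  have "b' = b + \<gamma> $ 1 $ 2 * d" "a' = a" "d' = d"
    using eq k l z \<open>k = 1\<close> \<open>l = 1\<close> by (simp_all add: one_pCons[symmetric])
  \<comment> \<open>Otherwise \<open>b' - b\<close> would be a nonzero multiple of \<open>d\<close>
    of degree less than \<open>degree d\<close>.\<close>
  have "\<gamma> $ 1 $ 2 = 0"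
  proof (rule ccontr)
    assume "\<gamma> $ 1 $ 2 \<noteq> 0"
    moreover from g(3) have "d \<noteq> 0" by auto
    ultimately have "degree d \<le> degree (\<gamma> $ 1 $ 2 * d)" "\<gamma> $ 1 $ 2 * d \<noteq> 0"
      by (auto simp: degree_mult_eq)
    moreover have "\<gamma> $ 1 $ 2 * d = b' - b" using \<open>b' = b + _\<close> by simp
    ultimately have "degree d \<le> degree (b' - b)" "b' - b \<noteq> 0" by simp_all
    moreover have "degree (b' - b) < degree d"
      using g(4) g'(4) \<open>d' = d\<close> \<open>b' - b \<noteq> 0\<close> degree_diff_less[of b' "degree d" b]
      by (cases "b = 0"; cases "b' = 0") simp_all
    ultimately show False by simp
  qed
  then show ?thesis using g(1) g'(1) \<open>b' = b + _\<close> \<open>a' = a\<close> \<open>d' = d\<close> by simp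
qed

text \<open>The first column is reduced to its gcd \<open>a\<close> by a matrix whose lower left
  entry \<open>t\<close> satisfies \<open>m $ 2 $ 1 = a * t\<close>. As a divisor of
  \<open>m $ 1 $ 1\<close>, \<open>a\<close> is a unit modulo \<nn>, which forces \<open>t\<close>
  into \<nn> and keeps the reduction inside \<open>Gamma0\<close>.\<close>

lemma Hermite_form:
  fixes m :: "'a::field poly ^ 2 ^ 2"
  assumes n: "ideal \<nn> polyring" and "m $ 2 $ 1 \<in> \<nn>" "coprime_to \<nn> (m $ 1 $ 1)" "det m \<noteq> 0"
  obtains \<gamma> h where "\<gamma> \<in> Gamma0 \<nn>" "h \<in> Hecke_set \<nn> (PIdl\<^bsub>polyring\<^esub> (det m))" "m = \<gamma> ** h"
proof -
  \<comment> \<open>The ideal generated by the first column: its monic generator is the gcd, and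
    membership of that generator supplies Bezout coefficients.\<close>
  define I where "I = {x * m $ 1 $ 1 + y * m $ 2 $ 1 | x y. True}"
  have "0 \<in> I" unfolding I_def by (force intro: exI[of _ 0])
  moreover have "a + b \<in> I" if "a \<in> I" "b \<in> I" for a b
  proof -
    from that obtain x y x' y' where "a = x * m $ 1 $ 1 + y * m $ 2 $ 1" "b = x' * m $ 1 $ 1 + y' * m $ 2 $ 1"
      by (auto simp: I_def)
    then have "a + b = (x + x') * m $ 1 $ 1 + (y + y') * m $ 2 $ 1" by (simp add: algebra_simps)
    then show ?thesis unfolding I_def by blast
  qed
  moreover have "r * a \<in> I" if "a \<in> I" for a r
  proof -
    from that obtain x y where "a = x * m $ 1 $ 1 + y * m $ 2 $ 1" by (auto simp: I_def)
    then have "r * a = (r * x) * m $ 1 $ 1 + (r * y) * m $ 2 $ 1" by (simp add: algebra_simps)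
    then show ?thesis unfolding I_def by blast
  qed
  ultimately have "ideal I polyring" unfolding ideal_polyring_iff by blast
  have m1: "m $ 1 $ 1 \<in> I" unfolding I_def by (rule CollectI, rule exI[of _ 1], rule exI[of _ 0]) simp
  have m2: "m $ 2 $ 1 \<in> I" unfolding I_def by (rule CollectI, rule exI[of _ 0], rule exI[of _ 1]) simp
  have "m $ 1 $ 1 \<noteq> 0 \<or> m $ 2 $ 1 \<noteq> 0" using assms(4) by (auto simp: det_2)
  with m1 m2 have "I \<noteq> {0}" by auto
  with \<open>ideal I polyring\<close> obtain a where a: "monic a" "I = PIdl\<^bsub>polyring\<^esub> a"
    by (rule ideal_polyring_principal)
  obtain s t where s: "m $ 1 $ 1 = a * s" and t: "m $ 2 $ 1 = a * t"
    using m1 m2 unfolding a PIdl_polyring by (auto elim!: dvdE)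
  have "a \<in> I" unfolding a PIdl_polyring by simp
  then obtain x y where "a = x * m $ 1 $ 1 + y * m $ 2 $ 1" by (auto simp: I_def)
  then have "a * (x * s + y * t) = a * 1" by (simp add: s t algebra_simps)
  moreover have "a \<noteq> 0" using a by auto
  ultimately have xy: "x * s + y * t = 1" by (metis mult_left_cancel)
  have cop: "coprime_to \<nn> a" using coprime_to_dvd[OF n assms(3)] s by simp
  have tn: "t \<in> \<nn>" using coprime_to_cancel[OF n cop] assms(2) t by simp
  \<comment> \<open>Multiplying \<open>m\<close> on the left by the matrix with rows
    \<open>(x, y)\<close> and \<open>(-t, s)\<close> gives the rows \<open>(a, B)\<close> and
    \<open>(0, D)\<close>.\<close>
  define D where "D = s * m $ 2 $ 2 - t * m $ 1 $ 2"
  define B where "B = x * m $ 1 $ 2 + y * m $ 2 $ 2"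
  have aD: "a * D = det m" by (simp add: det_2 D_def s t algebra_simps)
  with assms(4) have "D \<noteq> 0" by auto
  define k where "k = lead_coeff D"
  define d where "d = smult (inverse k) D"
  have k: "k \<noteq> 0" "D = [:k:] * d" "monic d" using \<open>D \<noteq> 0\<close> by (auto simp: k_def d_def)
  from k(3) have "d \<noteq> 0" by auto
  define q where "q = B div d"
  define b where "b = B mod d"
  have B: "B = q * d + b" by (simp add: q_def b_def)
  have deg: "b = 0 \<or> degree b < degree d"
    using degree_mod_less[OF \<open>d \<noteq> 0\<close>, of B] by (auto simp: b_def)
  \<comment> \<open>The inverse of that matrix, with rows \<open>(s, -y)\<close> and
    \<open>(t, x)\<close>, times the matrix with rows \<open>(1, q)\<close> and
    \<open>(0, k)\<close>, which undoes the scaling of \<open>D\<close> to \<open>d\<close> and the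
    reduction of \<open>B\<close> modulo \<open>d\<close>.\<close>
  define \<gamma> where "\<gamma> = mat2 s (s * q - y * [:k:]) t (t * q + x * [:k:])"
  have "det \<gamma> = [:k:] * (x * s + y * t)" by (simp add: det_2 \<gamma>_def algebra_simps)
  with xy k(1) tn have "\<gamma> \<in> Gamma0 \<nn>" by (simp add: Gamma0_iff \<gamma>_def is_unit_const_poly_iff dvd_field_iff xy)
  moreover have "PIdl\<^bsub>polyring\<^esub> (a * d) = PIdl\<^bsub>polyring\<^esub> (det m)"
  proof -
    have "det m = [:k:] * (a * d)" using aD k(2) by simp
    then show ?thesis using k(1) by (simp add: PIdl_polyring smult_dvd_iff)
  qed
  then have "mat2 a b 0 d \<in> Hecke_set \<nn> (PIdl\<^bsub>polyring\<^esub> (det m))"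
    using a(1) k(3) cop deg unfolding Hecke_set_def by blast
  moreover have "m = \<gamma> ** mat2 a b 0 d"
  proof -
    have "m $ 1 $ 2 = (x * s + y * t) * m $ 1 $ 2" "m $ 2 $ 2 = (x * s + y * t) * m $ 2 $ 2"
      by (simp_all add: xy)
    then have "m $ 1 $ 2 = s * B - y * D" "m $ 2 $ 2 = t * B + x * D"
      by (simp_all add: B_def D_def algebra_simps)
    then have "m $ 1 $ 2 = s * b + (s * q - y * [:k:]) * d" "m $ 2 $ 2 = t * b + (t * q + x * [:k:]) * d"
      unfolding k(2) B by (simp_all add: algebra_simps)
    then show ?thesis by (simp add: mat2_eq_iff matrix_mult_2 \<gamma>_def s t mult.commute)
  qed
  ultimately show ?thesis by (rule that)
qed

text \<open>The product \<open>g ** \<gamma>\<close> satisfies the hypotheses of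
  \<open>Hermite_form\<close>, and its determinant generates the same ideal as that of
  \<open>g\<close>.\<close>

lemma Hecke_set_mult_Gamma0:
  assumes n: "ideal \<nn> polyring" and g: "g \<in> Hecke_set \<nn> \<pp>" and \<gamma>: "\<gamma> \<in> Gamma0 \<nn>"
  obtains \<gamma>' h where "\<gamma>' \<in> Gamma0 \<nn>" "h \<in> Hecke_set \<nn> \<pp>" "g ** \<gamma> = \<gamma>' ** h"
proof -
  obtain a b d where g': "g = mat2 a b 0 d" "monic a" "monic d" "PIdl\<^bsub>polyring\<^esub> (a * d) = \<pp>" "coprime_to \<nn> a"
    using g by (auto simp: Hecke_set_def)
  have u: "det \<gamma> dvd 1" and c: "\<gamma> $ 2 $ 1 \<in> \<nn>" using \<gamma> by (auto simp: Gamma0_iff)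
  obtain e where e: "det \<gamma> * e = 1" using u by (metis dvdE)
  let ?m = "g ** \<gamma>"
  have ad: "a \<noteq> 0" "d \<noteq> 0" using g'(2,3) by auto
  have "det g = a * d" by (simp add: g' det_2)
  then have det: "det ?m = det \<gamma> * (a * d)" by (simp add: det_mul mult.commute)
  have "det \<gamma> \<noteq> 0" using e by auto
  with det ad have det0: "det ?m \<noteq> 0" by simp
  obtain k where k: "k \<noteq> 0" "det \<gamma> = [:k:]" using u unit_poly_obtain by metis
  then have "PIdl\<^bsub>polyring\<^esub> (det ?m) = \<pp>"
    unfolding det g'(4)[symmetric] by (simp add: PIdl_polyring smult_dvd_iff)
  moreover have "?m $ 2 $ 1 \<in> \<nn>"
    using n c unfolding ideal_polyring_iff by (simp add: matrix_mult_2 g')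
  moreover have "coprime_to \<nn> (?m $ 1 $ 1)"
  proof -
    obtain r where r: "1 - r * a \<in> \<nn>" using g'(5) coprime_to_iff[OF n] by blast
    \<comment> \<open>Modulo \<nn> the top left entry of \<open>?m\<close> is
      \<open>a * \<gamma> $ 1 $ 1\<close>. Here \<open>r\<close> inverts the first factor and
      \<open>e * \<gamma> $ 2 $ 2\<close> the second, because \<open>\<gamma> $ 2 $ 1\<close>
      vanishes there.\<close>
    let ?w = "r * (e * \<gamma> $ 2 $ 2)"
    have "1 - ?w * ?m $ 1 $ 1 = (1 - r * a) + (r * a) * (1 - e * \<gamma> $ 1 $ 1 * \<gamma> $ 2 $ 2) - (?w * b) * \<gamma> $ 2 $ 1"
      by (simp add: matrix_mult_2 g' algebra_simps)
    also have "1 - e * \<gamma> $ 1 $ 1 * \<gamma> $ 2 $ 2 = - e * \<gamma> $ 1 $ 2 * \<gamma> $ 2 $ 1"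
      using e by (simp add: det_2 algebra_simps)
    also have "(1 - r * a) + (r * a) * (- e * \<gamma> $ 1 $ 2 * \<gamma> $ 2 $ 1) - (?w * b) * \<gamma> $ 2 $ 1 =
       (1 - r * a) + (- r * a * e * \<gamma> $ 1 $ 2 - ?w * b) * \<gamma> $ 2 $ 1" by (simp add: algebra_simps)
    also have "\<dots> \<in> \<nn>" using n r c unfolding ideal_polyring_iff by blast
    finally show ?thesis using coprime_to_iff[OF n] by blast
  qed
  ultimately show ?thesis using Hermite_form[OF n, of ?m] det0 that by metis
qed

lemma finite_degree_le: "finite {f :: 'a::{field,finite} poly. degree f \<le> n}"
proof (rule finite_subset)
  show "{f :: 'a poly. degree f \<le> n} \<subseteq> Poly ` {xs. set xs \<subseteq> UNIV \<and> length xs \<le> Suc n}"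
  proof
    fix f :: "'a poly" assume "f \<in> {f. degree f \<le> n}"
    then have "length (coeffs f) \<le> Suc n" by (simp add: length_coeffs_degree coeffs_def)
    then show "f \<in> Poly ` {xs. set xs \<subseteq> UNIV \<and> length xs \<le> Suc n}"
      by (intro image_eqI[of _ _ "coeffs f"]) auto
  qed
  show "finite (Poly ` {xs. set xs \<subseteq> (UNIV :: 'a set) \<and> length xs \<le> Suc n})"
    by (intro finite_imageI finite_lists_length_le) simp
qed

lemma finite_Hecke_set: "finite (Hecke_set \<nn> (\<pp> :: 'a::{field,finite} poly set))"
proof (cases "Hecke_set \<nn> \<pp> = {}")
  case False
  then obtain a0 d0 where "monic a0" "monic d0" "PIdl\<^bsub>polyring\<^esub> (a0 * d0) = \<pp>"
    by (auto simp: Hecke_set_def)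
  \<comment> \<open>Every \<open>a * d\<close> divides the fixed product \<open>a0 * d0\<close>, as
    both generate the same ideal, so all entries have degree at most \<open>N\<close>.\<close>
  define N where "N = degree (a0 * d0)"
  have "a0 * d0 \<noteq> 0" using \<open>monic a0\<close> \<open>monic d0\<close> by auto
  have "Hecke_set \<nn> \<pp> \<subseteq> (\<lambda>(a, b, d). mat2 a b 0 d) ` ({f. degree f \<le> N} \<times> {f. degree f \<le> N} \<times> {f. degree f \<le> N})"
  proof
    fix g assume "g \<in> Hecke_set \<nn> \<pp>"
    then obtain a b d where g: "g = mat2 a b 0 d" "monic a" "monic d" "PIdl\<^bsub>polyring\<^esub> (a * d) = \<pp>"
        "b = 0 \<or> degree b < degree d"
      by (auto simp: Hecke_set_def)
    then have "a * d dvd a0 * d0"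
      using \<open>PIdl\<^bsub>polyring\<^esub> (a0 * d0) = \<pp>\<close> unfolding PIdl_polyring by (metis dvd_refl mem_Collect_eq)
    then have "degree (a * d) \<le> N" using \<open>a0 * d0 \<noteq> 0\<close> unfolding N_def by (rule dvd_imp_degree_le)
    moreover have "a \<noteq> 0" "d \<noteq> 0" using g by auto
    ultimately have "degree a \<le> N" "degree d \<le> N" by (auto simp: degree_mult_eq)
    then show "g \<in> (\<lambda>(a, b, d). mat2 a b 0 d) ` ({f. degree f \<le> N} \<times> {f. degree f \<le> N} \<times> {f. degree f \<le> N})"
      using g by (intro image_eqI[of _ _ "(a, b, d)"]) auto
  qed
  then show ?thesis by (rule finite_subset) (intro finite_imageI finite_cartesian_product finite_degree_le)
qed simp

section \<open>Divisors and quotient groups\<close>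

lemma div_degree_add: "div_degree (D + E) = div_degree D + div_degree E"
  unfolding div_degree_def by (rule setsum_keys_plus_distrib) auto

lemma div_degree_0 [simp]: "div_degree 0 = 0"
  by (simp add: div_degree_def)

lemma div_degree_minus: "div_degree (- D) = - div_degree D"
  using div_degree_add[of D "- D"] by simp

lemma div_degree_diff: "div_degree (D - E) = div_degree D - div_degree E"
  using div_degree_add[of "D - E" E] by simp

lemma div_degree_frag_of [simp]: "div_degree (frag_of x) = 1"
  by (simp add: div_degree_def)

lemma div_degree_sum: "div_degree (sum f A) = (\<Sum>x\<in>A. div_degree (f x))"
  by (induction A rule: infinite_finite_induct) (simp_all add: div_degree_add)

lemma carrier_Div0: "D \<in> carrier (Div0 S) \<longleftrightarrow> Poly_Mapping.keys D \<subseteq> S \<and> div_degree D = 0"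
  by (simp add: Div0_def)

lemma Div0_simps [simp]:
  "D \<otimes>\<^bsub>Div0 S\<^esub> E = D + E"
  "\<one>\<^bsub>Div0 S\<^esub> = 0"
  by (simp_all add: Div0_def free_Abelian_group_def)

lemma keys_sum_subset:
  "(\<And>x. x \<in> A \<Longrightarrow> Poly_Mapping.keys (f x) \<subseteq> S) \<Longrightarrow> Poly_Mapping.keys (sum f A) \<subseteq> S"
  by (induction A rule: infinite_finite_induct) (auto dest: subsetD[OF keys_add])

lemma Div0_closed:
  "0 \<in> carrier (Div0 S)"
  "D \<in> carrier (Div0 S) \<Longrightarrow> E \<in> carrier (Div0 S) \<Longrightarrow> D + E \<in> carrier (Div0 S)"
  "D \<in> carrier (Div0 S) \<Longrightarrow> E \<in> carrier (Div0 S) \<Longrightarrow> D - E \<in> carrier (Div0 S)"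
  "D \<in> carrier (Div0 S) \<Longrightarrow> - D \<in> carrier (Div0 S)"
  "(\<And>x. x \<in> A \<Longrightarrow> f x \<in> carrier (Div0 S)) \<Longrightarrow> sum f A \<in> carrier (Div0 S)"
  "r \<in> S \<Longrightarrow> s \<in> S \<Longrightarrow> frag_of s - frag_of r \<in> carrier (Div0 S)"
  unfolding carrier_Div0
  using keys_add[of D E] keys_diff[of D E] keys_diff[of "frag_of s" "frag_of r"] keys_sum_subset[of A f S]
  by (auto simp: div_degree_add div_degree_diff div_degree_minus div_degree_sum)

lemma comm_group_Div0 [simp]: "comm_group (Div0 S)"
proof (rule comm_groupI)
  fix D assume "D \<in> carrier (Div0 S)"
  then show "\<exists>E\<in>carrier (Div0 S). E \<otimes>\<^bsub>Div0 S\<^esub> D = \<one>\<^bsub>Div0 S\<^esub>"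
    by (intro bexI[of _ "- D"]) (auto intro: Div0_closed)
qed (auto simp: Div0_closed add_ac)

lemma group_Div0 [simp]: "group (Div0 S)"
  by (rule comm_group.axioms(2)) simp

lemma inv_Div0 [simp]: "D \<in> carrier (Div0 S) \<Longrightarrow> inv\<^bsub>Div0 S\<^esub> D = - D"
  by (rule group.inv_equality) (auto intro: Div0_closed)

lemma pow_Div0: "D [^]\<^bsub>Div0 S\<^esub> (n :: nat) = (\<Sum>i<n. D)"
  by (induction n) (simp_all add: nat_pow_def add.commute)

lemma finprod_Div0:
  assumes "finite A" "\<And>x. x \<in> A \<Longrightarrow> f x \<in> carrier (Div0 S)"
  shows "finprod (Div0 S) f A = sum f A"
  using assms
proof (induction A rule: finite_induct)
  case (insert x A)
  interpret comm_group "Div0 S" by simp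
  show ?case using insert by (simp add: finprod_insert Pi_def)
qed (simp add: comm_monoid.finprod_empty comm_group.axioms(1))

section \<open>Homomorphisms and the maps they induce on quotients\<close>

lemma hom_finprod:
  assumes G: "comm_group G" "comm_group G'" and h: "h \<in> hom G G'"
    and "\<And>x. x \<in> A \<Longrightarrow> f x \<in> carrier G"
  shows "h (finprod G f A) = finprod G' (\<lambda>x. h (f x)) A"
proof -
  interpret G: comm_group G by (rule G)
  interpret G': comm_group G' by (rule G)
  interpret group_hom G G' h by unfold_locales (rule h)
  \<comment> \<open>Over an infinite index set both products have the default value one, which
    \<open>h\<close> preserves.\<close>
  show ?thesis using assms(4)
    by (induction A rule: infinite_finite_induct) (simp_all add: Pi_def)
qed

text \<open>All representatives of the coset have the same image, since \<open>f h\<close> lies in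
  \<open>H'\<close> and is absorbed. Hence \<open>the_elem\<close> in \<open>induced_map\<close> is
  applied to a singleton.\<close>

lemma induced_map_rcos:
  assumes G: "comm_group G" "subgroup H G" "comm_group G'" "subgroup H' G'"
    and f: "f \<in> hom G G'" "\<And>h. h \<in> H \<Longrightarrow> f h \<in> H'" and x: "x \<in> carrier G"
  shows "induced_map G' H' f (H #>\<^bsub>G\<^esub> x) = H' #>\<^bsub>G'\<^esub> f x"
proof -
  interpret G: comm_group G by (rule G)
  interpret G': comm_group G' by (rule G)
  interpret group_hom G G' f by unfold_locales (rule f)
  interpret H: subgroup H G by (rule G)
  interpret H': subgroup H' G' by (rule G)
  have "(\<lambda>x. H' #>\<^bsub>G'\<^esub> f x) ` (H #>\<^bsub>G\<^esub> x) = {H' #>\<^bsub>G'\<^esub> f x}"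
  proof (rule set_eq_subset[THEN iffD2], intro conjI subsetI)
    fix y assume "y \<in> (\<lambda>x. H' #>\<^bsub>G'\<^esub> f x) ` (H #>\<^bsub>G\<^esub> x)"
    then obtain h where h: "h \<in> H" "y = H' #>\<^bsub>G'\<^esub> f (h \<otimes>\<^bsub>G\<^esub> x)" by (auto simp: r_coset_def)
    then have "y = (H' #>\<^bsub>G'\<^esub> f h) #>\<^bsub>G'\<^esub> f x"
      using x G'.coset_mult_assoc[OF H'.subset, of "f h" "f x"] by simp
    also have "H' #>\<^bsub>G'\<^esub> f h = H'" using f(2)[OF h(1)] by (simp add: H'.rcos_const)
    finally show "y \<in> {H' #>\<^bsub>G'\<^esub> f x}" by simp
  next
    fix y assume "y \<in> {H' #>\<^bsub>G'\<^esub> f x}"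
    moreover have "x \<in> H #>\<^bsub>G\<^esub> x" using G.rcos_self[OF x G(2)] .
    ultimately show "y \<in> (\<lambda>x. H' #>\<^bsub>G'\<^esub> f x) ` (H #>\<^bsub>G\<^esub> x)" by blast
  qed
  then show ?thesis by (simp add: induced_map_def)
qed

lemma induced_map_hom:
  assumes G: "comm_group G" "subgroup H G" "comm_group G'" "subgroup H' G'"
    and f: "f \<in> hom G G'" "\<And>h. h \<in> H \<Longrightarrow> f h \<in> H'"
  shows "induced_map G' H' f \<in> hom (G Mod H) (G' Mod H')"
proof -
  interpret G: comm_group G by (rule G)
  interpret G': comm_group G' by (rule G)
  interpret H: normal H G using G(2) by (rule G.subgroup_imp_normal)
  interpret H': normal H' G' using G(4) by (rule G'.subgroup_imp_normal)
  note eq = induced_map_rcos[OF G f]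
  show ?thesis
  proof (rule homI, goal_cases)
    case (1 C)
    then show ?case using f(1) by (auto simp: carrier_FactGroup eq hom_def)
  next
    case (2 C D)
    then obtain x y where "x \<in> carrier G" "y \<in> carrier G" "C = H #>\<^bsub>G\<^esub> x" "D = H #>\<^bsub>G\<^esub> y"
      by (auto simp: carrier_FactGroup)
    moreover have "f (x \<otimes>\<^bsub>G\<^esub> y) = f x \<otimes>\<^bsub>G'\<^esub> f y" "f x \<in> carrier G'" "f y \<in> carrier G'"
      using calculation(1,2) f(1) by (auto simp: hom_def)
    ultimately show ?case by (simp add: eq H.rcos_sum H'.rcos_sum)
  qed
qed

lemma subgroup_multiples:
  assumes "comm_group G"
  shows "subgroup (multiples p G) G"
proof -
  interpret comm_group G by (rule assms)
  have "(\<lambda>x. x [^]\<^bsub>G\<^esub> p) \<in> hom G G" by (rule homI) (auto simp: nat_pow_distrib)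
  then interpret group_hom G G "\<lambda>x. x [^]\<^bsub>G\<^esub> p" by unfold_locales
  show ?thesis unfolding multiples_def by (rule img_is_subgroup)
qed

lemma hom_multiples:
  assumes "group G" "group G'" "f \<in> hom G G'" "x \<in> multiples p G"
  shows "f x \<in> multiples p G'"
proof -
  obtain y where y: "y \<in> carrier G" "x = y [^]\<^bsub>G\<^esub> p" using assms(4) by (auto simp: multiples_def)
  then have "f x = f y [^]\<^bsub>G'\<^esub> p" using hom_nat_pow[OF assms(3)] assms(1,2) by simp
  moreover have "f y \<in> carrier G'" using y assms(3) by (auto simp: hom_def)
  ultimately show ?thesis by (auto simp: multiples_def)
qed

section \<open>Modular symbols modulo \<open>p\<close>\<close>

lemma div_act_0 [simp]: "div_act g 0 = 0"
  and div_act_add: "div_act g (D + E) = div_act g D + div_act g E"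
  and div_act_diff: "div_act g (D - E) = div_act g D - div_act g E"
  and div_act_minus: "div_act g (- D) = - div_act g D"
  and div_act_frag_of [simp]: "div_act g (frag_of r) = frag_of (mact g r)"
  by (simp_all add: div_act_def frag_extend_add frag_extend_diff frag_extend_minus)

lemma div_degree_div_act: "div_degree (div_act g D) = div_degree D"
  by (rule frag_induction[of D UNIV]) (simp_all add: div_act_diff div_degree_diff)

lemma div_act_closed: "D \<in> carrier (Div0 UNIV) \<Longrightarrow> div_act g D \<in> carrier (Div0 UNIV)"
  by (simp add: carrier_Div0 div_degree_div_act)

lemma div_act_mult: "det h \<noteq> 0 \<Longrightarrow> div_act (g ** h) D = div_act g (div_act h D)"
  by (rule frag_induction[of D UNIV]) (simp_all add: div_act_diff mact_mult)

lemma subgroup_coinv: "subgroup (coinv_subgroup \<nn>) (Div0 UNIV)"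
  unfolding coinv_subgroup_def
  by (rule group.generate_is_subgroup) (auto intro: Div0_closed div_act_closed)

lemma coinv_generator:
  "\<gamma> \<in> Gamma0 \<nn> \<Longrightarrow> D \<in> carrier (Div0 UNIV) \<Longrightarrow> div_act \<gamma> D - D \<in> coinv_subgroup \<nn>"
  unfolding coinv_subgroup_def by (rule generate.incl) blast

lemma coinv_subset: "D \<in> coinv_subgroup \<nn> \<Longrightarrow> D \<in> carrier (Div0 UNIV)"
  using subgroup.subset[OF subgroup_coinv] by blast

lemma coinv_closed:
  "0 \<in> coinv_subgroup \<nn>"
  "D \<in> coinv_subgroup \<nn> \<Longrightarrow> E \<in> coinv_subgroup \<nn> \<Longrightarrow> D + E \<in> coinv_subgroup \<nn>"
  "D \<in> coinv_subgroup \<nn> \<Longrightarrow> - D \<in> coinv_subgroup \<nn>"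
  using subgroup.one_closed[OF subgroup_coinv, of \<nn>] subgroup.m_closed[OF subgroup_coinv, of D \<nn> E]
    subgroup.m_inv_closed[OF subgroup_coinv, of D \<nn>] coinv_subset[of D \<nn>]
  by simp_all

lemma coinv_sum: "(\<And>x. x \<in> A \<Longrightarrow> f x \<in> coinv_subgroup \<nn>) \<Longrightarrow> sum f A \<in> coinv_subgroup \<nn>"
  by (induction A rule: infinite_finite_induct) (simp_all add: coinv_closed)

text \<open>Additive form of the induction over \<open>generate\<close>, where inverses of
  generators are covered by closure under negation. It reduces well-definedness of the Hecke
  operators and of the boundary map to generators.\<close>

lemma coinv_induct [consumes 1, case_names generator zero add minus]:
  assumes "D \<in> coinv_subgroup \<nn>"
    and gen: "\<And>\<gamma> D. \<gamma> \<in> Gamma0 \<nn> \<Longrightarrow> D \<in> carrier (Div0 UNIV) \<Longrightarrow> P (div_act \<gamma> D - D)"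
    and zero: "P 0" and add: "\<And>D E. P D \<Longrightarrow> P E \<Longrightarrow> P (D + E)" and minus: "\<And>D. P D \<Longrightarrow> P (- D)"
  shows "P D"
  using assms(1) unfolding coinv_subgroup_def
proof (induction rule: generate.induct)
  case (inv h)
  then obtain \<gamma> E where E: "\<gamma> \<in> Gamma0 \<nn>" "E \<in> carrier (Div0 UNIV)" "h = div_act \<gamma> E - E" by blast
  then have "h \<in> carrier (Div0 UNIV)" by (simp add: Div0_closed(3) div_act_closed)
  then have "inv\<^bsub>Div0 UNIV\<^esub> h = - h" by (rule inv_Div0)
  then show ?case using minus[OF gen[OF E(1,2)]] E(3) by simp
qed (use gen zero add in auto)

lemma Hecke_det_nonzero: "g \<in> Hecke_set \<nn> \<pp> \<Longrightarrow> det g \<noteq> 0"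
  by (auto simp: Hecke_set_def det_2)

text \<open>
  Right multiplication by \<open>\<gamma>\<close> permutes the cosets \<open>\<Gamma>\<^sub>0(\<nn>) g\<close> with \<open>g \<in> S\<^sub>\<pp>\<close>, so the Hecke operator
  respects the coinvariants.
\<close>

lemma Hecke_coinv_generator:
  fixes \<nn> \<pp> :: "'a::{field,finite} poly set"
  assumes n: "ideal \<nn> polyring" and \<gamma>: "\<gamma> \<in> Gamma0 \<nn>" and D: "D \<in> carrier (Div0 UNIV)"
  shows "(\<Sum>g\<in>Hecke_set \<nn> \<pp>. div_act g (div_act \<gamma> D - D)) \<in> coinv_subgroup \<nn>"
proof -
  let ?S = "Hecke_set \<nn> \<pp>"
  \<comment> \<open>For each \<open>g\<close> a factorisation of \<open>g ** \<gamma>\<close> is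
    chosen; its second factor will be the permutation \<phi> of \<open>?S\<close>.\<close>
  have "\<forall>g\<in>?S. \<exists>ch. fst ch \<in> Gamma0 \<nn> \<and> snd ch \<in> ?S \<and> g ** \<gamma> = fst ch ** snd ch"
    using Hecke_set_mult_Gamma0[OF n _ \<gamma>] by (metis fst_conv snd_conv)
  then obtain ch where ch: "\<And>g. g \<in> ?S \<Longrightarrow> fst (ch g) \<in> Gamma0 \<nn>" "\<And>g. g \<in> ?S \<Longrightarrow> snd (ch g) \<in> ?S"
      "\<And>g. g \<in> ?S \<Longrightarrow> g ** \<gamma> = fst (ch g) ** snd (ch g)"
    by metis
  define c \<phi> where "c g = fst (ch g)" and "\<phi> g = snd (ch g)" for g
  have c: "c g \<in> Gamma0 \<nn>" "\<phi> g \<in> ?S" "g ** \<gamma> = c g ** \<phi> g" if "g \<in> ?S" for g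
    using ch that by (auto simp: c_def \<phi>_def)
  have inv: "\<exists>h. invertible h \<and> h ** \<delta> = mat 1 \<and> \<delta> ** h = mat 1" if "\<delta> \<in> Gamma0 \<nn>" for \<delta>
    using that unfolding Gamma0_def GL2_def invertible_def by blast
  \<comment> \<open>If \<open>\<phi> g = \<phi> g'\<close>, then \<open>g'\<close> is
    \<open>g\<close> multiplied on the left by \<open>c g'\<close> and the inverse of
    \<open>c g\<close>, so \<open>Hecke_set_unique\<close> applies.\<close>
  have "inj_on \<phi> ?S"
  proof (rule inj_onI)
    fix g g' assume g: "g \<in> ?S" "g' \<in> ?S" "\<phi> g = \<phi> g'"
    obtain ci where ci: "invertible ci" "ci ** c g = mat 1" using inv c(1)[OF g(1)] by blast
    obtain \<gamma>i where \<gamma>i: "\<gamma> ** \<gamma>i = mat 1" using inv \<gamma> by blast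
    have "invertible (c g')" using c(1)[OF g(2)] by (simp add: Gamma0_def GL2_def)
    then have "c g' ** ci \<in> GL2" using ci(1) by (simp add: GL2_def invertible_mult)
    moreover have "(c g' ** ci) ** g = g'"
    proof -
      have "(c g' ** ci) ** g = (c g' ** ci) ** (g ** \<gamma>) ** \<gamma>i"
        using \<gamma>i by (simp add: matrix_mul_assoc[symmetric])
      also have "\<dots> = c g' ** (ci ** c g) ** \<phi> g ** \<gamma>i"
        unfolding c(3)[OF g(1)] by (simp add: matrix_mul_assoc)
      also have "\<dots> = (g' ** \<gamma>) ** \<gamma>i" unfolding c(3)[OF g(2)] by (simp add: ci g(3))
      also have "\<dots> = g'" using \<gamma>i by (simp add: matrix_mul_assoc[symmetric])
      finally show ?thesis .
    qed
    ultimately show "g = g'" using Hecke_set_unique g by blast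
  qed
  moreover have "\<phi> ` ?S = ?S"
    using endo_inj_surj[OF finite_Hecke_set _ \<open>inj_on \<phi> ?S\<close>] c(2) by blast
  ultimately have bij: "bij_betw \<phi> ?S ?S" by (simp add: bij_betw_def)
  have "(\<Sum>g\<in>?S. div_act g (div_act \<gamma> D)) = (\<Sum>g\<in>?S. div_act (c g) (div_act (\<phi> g) D))"
  proof (rule sum.cong)
    fix g assume g: "g \<in> ?S"
    have "det \<gamma> \<noteq> 0" using \<gamma> by (auto simp: Gamma0_iff)
    then show "div_act g (div_act \<gamma> D) = div_act (c g) (div_act (\<phi> g) D)"
      using c[OF g] Hecke_det_nonzero by (metis div_act_mult)
  qed simp
  \<comment> \<open>Reindexing along \<phi> pairs each translated term with an equivalent one, so
    every difference is a generator of the coinvariant relations.\<close>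
  moreover have "(\<Sum>g\<in>?S. div_act g D) = (\<Sum>g\<in>?S. div_act (\<phi> g) D)"
    using sum.reindex_bij_betw[OF bij, of "\<lambda>g. div_act g D"] by simp
  ultimately have "(\<Sum>g\<in>?S. div_act g (div_act \<gamma> D - D)) =
      (\<Sum>g\<in>?S. div_act (c g) (div_act (\<phi> g) D) - div_act (\<phi> g) D)"
    by (simp add: div_act_diff sum_subtractf)
  also have "\<dots> \<in> coinv_subgroup \<nn>"
    by (intro coinv_sum coinv_generator c div_act_closed D)
  finally show ?thesis .
qed

lemma Hecke_hom: "(\<lambda>D. \<Sum>g\<in>Hecke_set \<nn> \<pp>. div_act g D) \<in> hom (Div0 UNIV) (Div0 UNIV)"
  by (rule homI) (auto simp: div_act_add sum.distrib intro: Div0_closed div_act_closed)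

lemma Hecke_coinv:
  fixes \<nn> \<pp> :: "'a::{field,finite} poly set"
  assumes n: "ideal \<nn> polyring" and D: "D \<in> coinv_subgroup \<nn>"
  shows "(\<Sum>g\<in>Hecke_set \<nn> \<pp>. div_act g D) \<in> coinv_subgroup \<nn>"
  using D
  by (induction rule: coinv_induct)
     (simp_all add: Hecke_coinv_generator[OF n] div_act_add div_act_minus sum.distrib sum_negf coinv_closed)

section \<open>Reduction modulo \<open>p\<close> and the kernel of the symbol map\<close>

lemma comm_group_MS [simp]: "comm_group (MS \<nn>)"
  unfolding MS_def by (rule comm_group.abelian_FactGroup[OF comm_group_Div0 subgroup_coinv])

lemma comm_group_mod_p: "comm_group G \<Longrightarrow> comm_group (mod_p p G)"
  unfolding mod_p_def by (rule comm_group.abelian_FactGroup[OF _ subgroup_multiples])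

text \<open>The composite projection from degree-0 divisors to modular symbols modulo
  \<open>p\<close>. Later identities are proved between divisors and transported through this
  homomorphism.\<close>

definition symbol_mod ::
  "nat \<Rightarrow> 'a::field poly set \<Rightarrow> ('a poly fract projline \<Rightarrow>\<^sub>0 int) \<Rightarrow> ('a poly fract projline \<Rightarrow>\<^sub>0 int) set set"
  where "symbol_mod p \<nn> D =
    multiples p (MS \<nn>) #>\<^bsub>MS \<nn>\<^esub> (coinv_subgroup \<nn> #>\<^bsub>Div0 UNIV\<^esub> D)"

lemma coinv_rcos_hom: "(\<lambda>D. coinv_subgroup \<nn> #>\<^bsub>Div0 UNIV\<^esub> D) \<in> hom (Div0 UNIV) (MS \<nn>)"
  unfolding MS_def
  by (rule normal.r_coset_hom_Mod[OF comm_group.subgroup_imp_normal[OF comm_group_Div0 subgroup_coinv]])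

lemma multiples_rcos_hom:
  assumes "comm_group G"
  shows "(\<lambda>x. multiples p G #>\<^bsub>G\<^esub> x) \<in> hom G (mod_p p G)"
  unfolding mod_p_def
  by (rule normal.r_coset_hom_Mod[OF comm_group.subgroup_imp_normal[OF assms subgroup_multiples[OF assms]]])

lemma symbol_mod_hom: "symbol_mod p \<nn> \<in> hom (Div0 UNIV) (mod_p p (MS \<nn>))"
  using hom_compose[OF coinv_rcos_hom multiples_rcos_hom[OF comm_group_MS]]
  unfolding symbol_mod_def comp_def .

lemma group_hom_symbol_mod: "group_hom (Div0 UNIV) (mod_p p (MS \<nn>)) (symbol_mod p \<nn>)"
  by (intro group_hom.intro group_hom_axioms.intro group_Div0 symbol_mod_hom
      comm_group.axioms(2) comm_group_mod_p comm_group_MS)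

lemma rcos_in_MS: "D \<in> carrier (Div0 UNIV) \<Longrightarrow> coinv_subgroup \<nn> #>\<^bsub>Div0 UNIV\<^esub> D \<in> carrier (MS \<nn>)"
  by (simp add: MS_def carrier_FactGroup)

text \<open>The kernel of \<open>symbol_mod\<close>. Congruence modulo this group of divisors
  replaces equality between cosets of cosets.\<close>

definition null_mod :: "nat \<Rightarrow> 'a::field poly set \<Rightarrow> ('a poly fract projline \<Rightarrow>\<^sub>0 int) set" where
  "null_mod p \<nn> = {D \<in> carrier (Div0 UNIV). symbol_mod p \<nn> D = \<one>\<^bsub>mod_p p (MS \<nn>)\<^esub>}"

lemma subgroup_null_mod: "subgroup (null_mod p \<nn>) (Div0 UNIV)"
proof -
  interpret group_hom "Div0 UNIV" "mod_p p (MS \<nn>)" "symbol_mod p \<nn>"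
    by (rule group_hom_symbol_mod)
  show ?thesis using subgroup_kernel by (simp add: kernel_def null_mod_def)
qed

lemma null_mod_subset: "D \<in> null_mod p \<nn> \<Longrightarrow> D \<in> carrier (Div0 UNIV)"
  by (simp add: null_mod_def)

lemma null_mod_closed:
  "0 \<in> null_mod p \<nn>"
  "D \<in> null_mod p \<nn> \<Longrightarrow> E \<in> null_mod p \<nn> \<Longrightarrow> D + E \<in> null_mod p \<nn>"
  "D \<in> null_mod p \<nn> \<Longrightarrow> - D \<in> null_mod p \<nn>"
  using subgroup.one_closed[OF subgroup_null_mod, of p \<nn>] subgroup.m_closed[OF subgroup_null_mod, of D p \<nn> E]
    subgroup.m_inv_closed[OF subgroup_null_mod, of D p \<nn>] null_mod_subset[of D p \<nn>]
  by simp_all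

lemma null_mod_sum: "(\<And>x. x \<in> A \<Longrightarrow> f x \<in> null_mod p \<nn>) \<Longrightarrow> sum f A \<in> null_mod p \<nn>"
  by (induction A rule: infinite_finite_induct) (simp_all add: null_mod_closed)

text \<open>First source of kernel elements: the coinvariant relations, which vanish before
  reduction modulo \<open>p\<close>.\<close>

lemma coinv_null_mod:
  assumes "D \<in> coinv_subgroup \<nn>"
  shows "D \<in> null_mod p \<nn>"
proof -
  have D: "D \<in> carrier (Div0 UNIV)" using assms by (rule coinv_subset)
  have "coinv_subgroup \<nn> #>\<^bsub>Div0 UNIV\<^esub> D = coinv_subgroup \<nn>"
    by (rule subgroup.rcos_const[OF subgroup_coinv group_Div0 assms])
  also have "\<dots> = \<one>\<^bsub>MS \<nn>\<^esub>" by (simp add: MS_def)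
  finally have "symbol_mod p \<nn> D = multiples p (MS \<nn>) #>\<^bsub>MS \<nn>\<^esub> \<one>\<^bsub>MS \<nn>\<^esub>"
    by (simp add: symbol_mod_def)
  also have "\<dots> = multiples p (MS \<nn>)"
    using subgroup_multiples[OF comm_group_MS, of p \<nn>] comm_group.axioms(2)[OF comm_group_MS, of \<nn>]
    by (metis subgroup.rcos_const subgroup.one_closed)
  finally show ?thesis using D by (simp add: null_mod_def mod_p_def)
qed

text \<open>Second source of kernel elements: the constant sum is a \<open>p\<close>-th power in the
  multiplicative notation of the group records.\<close>

lemma multiple_null_mod:
  assumes D: "D \<in> carrier (Div0 UNIV)"
  shows "(\<Sum>i<p. D) \<in> null_mod p \<nn>"
proof -
  let ?c = "\<lambda>D. coinv_subgroup \<nn> #>\<^bsub>Div0 UNIV\<^esub> D"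
  have MS: "group (MS \<nn>)" by (rule comm_group.axioms(2)) simp
  have "?c (\<Sum>i<p. D) = ?c D [^]\<^bsub>MS \<nn>\<^esub> p"
    using hom_nat_pow[OF coinv_rcos_hom D group_Div0 MS] by (simp add: pow_Div0)
  also have "\<dots> \<in> multiples p (MS \<nn>)"
    using rcos_in_MS[OF D] by (simp add: multiples_def)
  finally have "symbol_mod p \<nn> (\<Sum>i<p. D) = multiples p (MS \<nn>)"
    unfolding symbol_mod_def
    using subgroup_multiples[OF comm_group_MS, of p \<nn>] MS by (metis subgroup.rcos_const)
  then show ?thesis using D by (simp add: null_mod_def mod_p_def Div0_closed(5))
qed

lemma symbol_mod_cong:
  assumes "D \<in> carrier (Div0 UNIV)" "D - E \<in> null_mod p \<nn>"
  shows "symbol_mod p \<nn> D = symbol_mod p \<nn> E"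
proof -
  interpret group_hom "Div0 UNIV" "mod_p p (MS \<nn>)" "symbol_mod p \<nn>"
    by (rule group_hom_symbol_mod)
  have E: "E \<in> carrier (Div0 UNIV)"
    using Div0_closed(3)[OF assms(1) null_mod_subset[OF assms(2)]] by simp
  have "symbol_mod p \<nn> ((D - E) \<otimes>\<^bsub>Div0 UNIV\<^esub> E) = symbol_mod p \<nn> (D - E) \<otimes>\<^bsub>mod_p p (MS \<nn>)\<^esub> symbol_mod p \<nn> E"
    using assms(2) E by (intro hom_mult) (auto simp: null_mod_def)
  also have "symbol_mod p \<nn> (D - E) = \<one>\<^bsub>mod_p p (MS \<nn>)\<^esub>" using assms(2) by (simp add: null_mod_def)
  finally show ?thesis using E by simp
qed

text \<open>Moves the products of the theorem inside \<open>symbol_mod\<close>, where they become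
  ordinary sums of divisors.\<close>

lemma finprod_symbol_mod:
  assumes "finite A" "\<And>x. x \<in> A \<Longrightarrow> f x \<in> carrier (Div0 UNIV)"
  shows "finprod (mod_p p (MS \<nn>)) (\<lambda>x. symbol_mod p \<nn> (f x)) A = symbol_mod p \<nn> (sum f A)"
  using hom_finprod[OF comm_group_Div0 comm_group_mod_p[OF comm_group_MS] symbol_mod_hom, of A f] assms
  by (simp add: finprod_Div0)

text \<open>\<open>Hecke_mod\<close> is induced by an induced map; \<open>induced_map_rcos\<close>
  evaluates first the outer and then the inner one on a representative.\<close>

lemma Hecke_mod_symbol_mod:
  fixes \<nn> \<pp> :: "'a::{field,finite} poly set"
  assumes n: "ideal \<nn> polyring" and D: "D \<in> carrier (Div0 UNIV)"
  shows "Hecke_mod p \<nn> \<pp> (symbol_mod p \<nn> D) = symbol_mod p \<nn> (\<Sum>g\<in>Hecke_set \<nn> \<pp>. div_act g D)"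
proof -
  note co = comm_group_Div0 subgroup_coinv[of \<nn>]
  have H: "Hecke \<nn> \<pp> \<in> hom (MS \<nn>) (MS \<nn>)"
    unfolding Hecke_def MS_def by (rule induced_map_hom[OF co co Hecke_hom Hecke_coinv[OF n]])
  have MS: "group (MS \<nn>)" by (rule comm_group.axioms(2)) simp
  note m = comm_group_MS subgroup_multiples[OF comm_group_MS, of p]
  have "Hecke_mod p \<nn> \<pp> (symbol_mod p \<nn> D) =
      multiples p (MS \<nn>) #>\<^bsub>MS \<nn>\<^esub> Hecke \<nn> \<pp> (coinv_subgroup \<nn> #>\<^bsub>Div0 UNIV\<^esub> D)"
    unfolding Hecke_mod_def symbol_mod_def
    by (rule induced_map_rcos[OF m m H hom_multiples[OF MS MS H] rcos_in_MS[OF D]])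
  also have "Hecke \<nn> \<pp> (coinv_subgroup \<nn> #>\<^bsub>Div0 UNIV\<^esub> D) =
      coinv_subgroup \<nn> #>\<^bsub>Div0 UNIV\<^esub> (\<Sum>g\<in>Hecke_set \<nn> \<pp>. div_act g D)"
    unfolding Hecke_def by (rule induced_map_rcos[OF co co Hecke_hom Hecke_coinv[OF n] D])
  finally show ?thesis by (simp add: symbol_mod_def)
qed

section \<open>Manin-Teitelbaum symbols computed from a matrix\<close>

lemma coinv_rcos_eqI:
  assumes "E \<in> carrier (Div0 UNIV)" "D - E \<in> coinv_subgroup \<nn>"
  shows "coinv_subgroup \<nn> #>\<^bsub>Div0 UNIV\<^esub> D = coinv_subgroup \<nn> #>\<^bsub>Div0 UNIV\<^esub> E"
proof (rule group.repr_independence[OF group_Div0, symmetric])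
  show "D \<in> coinv_subgroup \<nn> #>\<^bsub>Div0 UNIV\<^esub> E"
    using assms(2) by (force simp: r_coset_def)
qed (simp_all add: assms subgroup_coinv)

text \<open>The determinant relation is a Bezout identity between the entries of the bottom row, so
  these already generate the whole ring.\<close>

lemma GL2_row_in_P1_pairs:
  assumes n: "ideal \<nn> polyring" and "g \<in> GL2"
  shows "(g $ 2 $ 1, g $ 2 $ 2) \<in> P1_pairs \<nn>"
proof -
  obtain e where e: "det g * e = 1" using assms(2) GL2_iff by (metis dvdE)
  have "1 - g $ 2 $ 1 * (- e * g $ 1 $ 2) = g $ 2 $ 2 * (e * g $ 1 $ 1)"
    using e by (simp add: det_2 algebra_simps)
  then have "\<exists>i\<in>PIdl\<^bsub>polyring\<^esub> (g $ 2 $ 1). 1 - i \<in> PIdl\<^bsub>polyring\<^esub> (g $ 2 $ 2)"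
    unfolding PIdl_polyring
    by (intro bexI[of _ "g $ 2 $ 1 * (- e * g $ 1 $ 2)"]) (simp_all only: mem_Collect_eq dvd_triv_left)
  then have "PIdl\<^bsub>polyring\<^esub> (g $ 2 $ 1) <+>\<^bsub>polyring\<^esub> PIdl\<^bsub>polyring\<^esub> (g $ 2 $ 2) = UNIV"
    by (simp add: add_ideal_eq_UNIV_iff ideal_PIdl_polyring)
  moreover have "UNIV <+>\<^bsub>polyring\<^esub> \<nn> = UNIV"
  proof -
    have "x + 0 \<in> UNIV <+>\<^bsub>polyring\<^esub> \<nn>" for x :: "'a poly"
      using n unfolding ideal_polyring_iff set_add_def set_mult_def by fastforce
    then show ?thesis by auto
  qed
  ultimately show ?thesis by (simp add: P1_pairs_def)
qed

lemma MT_symbol_eq: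
  assumes n: "ideal \<nn> polyring" and g: "g \<in> GL2"
  shows "MT_symbol \<nn> (g $ 2 $ 1) (g $ 2 $ 2) = modsym \<nn> (mact g (Fin 0)) (mact g Infty)"
proof -
  let ?R = "P1_rel \<nn> `` {(g $ 2 $ 1, g $ 2 $ 2)}"
  have "modsym \<nn> (mact h (Fin 0)) (mact h Infty) = modsym \<nn> (mact g (Fin 0)) (mact g Infty)"
    if h: "h \<in> GL2" "(h $ 2 $ 1, h $ 2 $ 2) \<in> ?R" for h
  proof -
    obtain w where w: "h $ 2 $ 1 - w * g $ 2 $ 1 \<in> \<nn>" "h $ 2 $ 2 - w * g $ 2 $ 2 \<in> \<nn>"
      using h(2) by (auto simp: P1_rel_def)
    \<comment> \<open>Eliminates the multiplier \<open>w\<close> from the two congruences.\<close>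
    have "g $ 2 $ 2 * (h $ 2 $ 1 - w * g $ 2 $ 1) - g $ 2 $ 1 * (h $ 2 $ 2 - w * g $ 2 $ 2) \<in> \<nn>"
      by (rule ideal_polyring_diff[OF n]) (use n w in \<open>auto simp: ideal_polyring_iff\<close>)
    then have "h $ 2 $ 1 * g $ 2 $ 2 - h $ 2 $ 2 * g $ 2 $ 1 \<in> \<nn>"
      by (simp add: algebra_simps)
    then obtain \<gamma> where \<gamma>: "\<gamma> \<in> Gamma0 \<nn>" "h = \<gamma> ** g"
      by (rule Gamma0_solve[OF n h(1) g])
    let ?D = "frag_of (mact g Infty) - frag_of (mact g (Fin 0))"
    have D: "?D \<in> carrier (Div0 UNIV)" by (simp add: Div0_closed(6))
    have "frag_of (mact h Infty) - frag_of (mact h (Fin 0)) = div_act \<gamma> ?D"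
      using g by (simp add: \<gamma>(2) mact_mult GL2_det_nonzero div_act_diff)
    then show ?thesis
      unfolding modsym_def by (metis coinv_rcos_eqI[OF D] coinv_generator[OF \<gamma>(1) D])
  qed
  moreover have "(g $ 2 $ 1, g $ 2 $ 2) \<in> ?R"
    using GL2_row_in_P1_pairs[OF n g] n coprime_to_1[OF n]
    by (auto simp: P1_rel_def ideal_polyring_iff intro!: exI[of _ 1])
  ultimately have "{modsym \<nn> (mact h (Fin 0)) (mact h Infty) | h. h \<in> GL2 \<and> (h $ 2 $ 1, h $ 2 $ 2) \<in> ?R} =
      {modsym \<nn> (mact g (Fin 0)) (mact g Infty)}" using g by blast
  then show ?thesis unfolding MT_symbol_def by simp
qed

lemma MT_symbol_mod_eq:
  assumes "ideal \<nn> polyring" and "det (mat2 a b u v) dvd 1"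
  shows "MT_symbol_mod p \<nn> u v =
    symbol_mod p \<nn> (frag_of (mact (mat2 a b u v) Infty) - frag_of (mact (mat2 a b u v) (Fin 0)))"
  using MT_symbol_eq[OF assms(1), of "mat2 a b u v"] assms(2)
  by (simp add: MT_symbol_mod_def symbol_mod_def modsym_def GL2_iff)

section \<open>Cusps and the boundary map\<close>

lemma cusp_mact:
  assumes n: "ideal \<nn> polyring" and \<gamma>: "\<gamma> \<in> Gamma0 \<nn>"
  shows "cusp \<nn> (mact \<gamma> r) = cusp \<nn> r"
proof -
  have "det \<gamma> \<noteq> 0" using \<gamma> by (auto simp: Gamma0_iff)
  note mult = mact_mult[OF this]
  have GL: "\<delta> \<in> GL2" if "\<delta> \<in> Gamma0 \<nn>" for \<delta> using that by (simp add: Gamma0_def)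
  show ?thesis
  proof (intro Set.set_eqI iffI)
    fix s assume "s \<in> cusp \<nn> (mact \<gamma> r)"
    then show "s \<in> cusp \<nn> r"
      using Gamma0_mult[OF n _ \<gamma>] by (auto simp: cusp_def mult[symmetric])
  next
    fix s assume "s \<in> cusp \<nn> r"
    then obtain h where h: "h \<in> Gamma0 \<nn>" "s = mact h r" by (auto simp: cusp_def)
    \<comment> \<open>Both lower left entries lie in \<nn>, hence so does the minor of the bottom
      rows, and \<open>h\<close> can be divided by \<gamma> on the right.\<close>
    have "\<gamma> $ 2 $ 2 * h $ 2 $ 1 - h $ 2 $ 2 * \<gamma> $ 2 $ 1 \<in> \<nn>"
      by (rule ideal_polyring_diff[OF n]) (use n \<gamma> h in \<open>auto simp: ideal_polyring_iff Gamma0_iff\<close>)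
    then obtain \<delta> where "\<delta> \<in> Gamma0 \<nn>" "h = \<delta> ** \<gamma>"
      using Gamma0_solve[OF n GL[OF h(1)] GL[OF \<gamma>]] by (auto simp: mult.commute)
    then show "s \<in> cusp \<nn> (mact \<gamma> r)"
      using h(2) mult by (auto simp: cusp_def)
  qed
qed

text \<open>The lift of \<open>boundary\<close> from cosets to divisors, free of
  \<open>the_elem\<close>.\<close>

definition boundary_div ::
  "'a::field poly set \<Rightarrow> ('a poly fract projline \<Rightarrow>\<^sub>0 int) \<Rightarrow> ('a poly fract projline set \<Rightarrow>\<^sub>0 int)" where
  "boundary_div \<nn> = frag_extend (\<lambda>r. frag_of (cusp \<nn> r))"

lemma boundary_div_closed:
  assumes "D \<in> carrier (Div0 UNIV)"
  shows "boundary_div \<nn> D \<in> carrier (cusp_Div0 \<nn>)"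
proof -
  have "div_degree (boundary_div \<nn> D) = div_degree D"
    unfolding boundary_div_def
    by (rule frag_induction[of D UNIV]) (simp_all add: frag_extend_diff div_degree_diff)
  moreover have "Poly_Mapping.keys (boundary_div \<nn> D) \<subseteq> range (cusp \<nn>)"
    unfolding boundary_div_def using keys_frag_extend[of "\<lambda>r. frag_of (cusp \<nn> r)" D] by auto
  ultimately show ?thesis using assms by (simp add: cusp_Div0_def carrier_Div0)
qed

lemma boundary_div_coinv:
  assumes n: "ideal \<nn> polyring" and "D \<in> coinv_subgroup \<nn>"
  shows "boundary_div \<nn> D = 0"
  using assms(2)
proof (induction rule: coinv_induct)
  case (generator \<gamma> D)
  have "boundary_div \<nn> (div_act \<gamma> D) = boundary_div \<nn> D"
    unfolding boundary_div_def
    by (rule frag_induction[of D UNIV])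
       (simp_all add: frag_extend_diff div_act_diff cusp_mact[OF n generator(1)])
  then show ?case by (simp add: boundary_div_def frag_extend_diff)
qed (simp_all add: boundary_div_def frag_extend_add frag_extend_minus)

text \<open>The coinvariant relations have boundary 0, so all members of a coset share one
  boundary.\<close>

lemma boundary_rcos:
  assumes n: "ideal \<nn> polyring"
  shows "boundary \<nn> (coinv_subgroup \<nn> #>\<^bsub>Div0 UNIV\<^esub> D) = boundary_div \<nn> D"
proof -
  have "boundary_div \<nn> ` (coinv_subgroup \<nn> #>\<^bsub>Div0 UNIV\<^esub> D) = (\<lambda>C. boundary_div \<nn> (C + D)) ` coinv_subgroup \<nn>"
    by (auto simp: r_coset_def)
  also have "\<dots> = (\<lambda>C. boundary_div \<nn> D) ` coinv_subgroup \<nn>"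
    using boundary_div_coinv[OF n] by (intro image_cong) (auto simp: boundary_div_def frag_extend_add)
  also have "\<dots> = {boundary_div \<nn> D}" using coinv_closed(1)[of \<nn>] by auto
  finally show ?thesis by (simp add: boundary_def boundary_div_def)
qed

lemma boundary_hom:
  assumes n: "ideal \<nn> polyring"
  shows "boundary \<nn> \<in> hom (MS \<nn>) (cusp_Div0 \<nn>)"
proof (rule homI, goal_cases)
  case (1 C)
  then show ?case by (auto simp: MS_def carrier_FactGroup boundary_rcos[OF n] boundary_div_closed)
next
  case (2 C C')
  then obtain D D' where D: "D \<in> carrier (Div0 UNIV)" "C = coinv_subgroup \<nn> #>\<^bsub>Div0 UNIV\<^esub> D"
      "D' \<in> carrier (Div0 UNIV)" "C' = coinv_subgroup \<nn> #>\<^bsub>Div0 UNIV\<^esub> D'"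
    by (auto simp: MS_def carrier_FactGroup)
  then have "C \<otimes>\<^bsub>MS \<nn>\<^esub> C' = coinv_subgroup \<nn> #>\<^bsub>Div0 UNIV\<^esub> (D + D')"
    using coinv_rcos_hom[of \<nn>] by (simp add: hom_def)
  then show ?case using D
    by (simp add: boundary_rcos[OF n] boundary_div_def frag_extend_add cusp_Div0_def)
qed

lemma cuspidal_mod_symbol_mod:
  assumes n: "ideal \<nn> polyring" and D: "D \<in> carrier (Div0 UNIV)" and "boundary_div \<nn> D = 0"
  shows "cuspidal_mod p \<nn> (symbol_mod p \<nn> D)"
proof -
  have MS: "group (MS \<nn>)" by (rule comm_group.axioms(2)) simp
  have C: "comm_group (cusp_Div0 \<nn>)" "group (cusp_Div0 \<nn>)" by (simp_all add: cusp_Div0_def)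
  have "boundary_mod p \<nn> (symbol_mod p \<nn> D) = multiples p (cusp_Div0 \<nn>) #>\<^bsub>cusp_Div0 \<nn>\<^esub>
      boundary \<nn> (coinv_subgroup \<nn> #>\<^bsub>Div0 UNIV\<^esub> D)"
    unfolding boundary_mod_def symbol_mod_def
    by (rule induced_map_rcos[OF comm_group_MS subgroup_multiples[OF comm_group_MS] C(1)
        subgroup_multiples[OF C(1)] boundary_hom[OF n] hom_multiples[OF MS C(2) boundary_hom[OF n]]
        rcos_in_MS[OF D]])
  also have "boundary \<nn> (coinv_subgroup \<nn> #>\<^bsub>Div0 UNIV\<^esub> D) = \<one>\<^bsub>cusp_Div0 \<nn>\<^esub>"
    by (simp add: boundary_rcos[OF n] assms(3) cusp_Div0_def)
  also have "multiples p (cusp_Div0 \<nn>) #>\<^bsub>cusp_Div0 \<nn>\<^esub> \<one>\<^bsub>cusp_Div0 \<nn>\<^esub> = multiples p (cusp_Div0 \<nn>)"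
    using subgroup_multiples[OF C(1), of p] C(2) by (metis subgroup.rcos_const subgroup.one_closed)
  also have "\<dots> = \<one>\<^bsub>mod_p p (cusp_Div0 \<nn>)\<^esub>" by (simp add: mod_p_def)
  finally show ?thesis
    using symbol_mod_hom[of p \<nn>] D by (simp add: cuspidal_mod_def kernel_def hom_def Pi_iff)
qed

text \<open>With \<open>a\<close> an inverse of \<open>u\<close> modulo \<nn>, the matrix with rows
  \<open>(a, 1)\<close> and \<open>(a * u - 1, u)\<close> has determinant 1, lies in
  \<open>Gamma0\<close> and carries 0 to \<open>1/u\<close>.\<close>

lemma cusp_unit_fraction:
  assumes n: "ideal \<nn> polyring" and u: "coprime_to \<nn> u" "u \<noteq> 0"
  shows "cusp \<nn> (Fin (1 / to_fract u)) = cusp \<nn> (Fin 0)"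
proof -
  obtain a where a: "1 - a * u \<in> \<nn>" using u(1) coprime_to_iff[OF n] by blast
  define \<gamma> where "\<gamma> = mat2 a 1 (- (1 - a * u)) u"
  have "- (1 - a * u) \<in> \<nn>" using ideal_polyring_diff[OF n _ a, of 0] n by (simp add: ideal_polyring_iff)
  moreover have "det \<gamma> = 1" by (simp add: \<gamma>_def det_2)
  ultimately have "\<gamma> \<in> Gamma0 \<nn>" by (simp add: Gamma0_iff \<gamma>_def)
  moreover have "mact \<gamma> (Fin 0) = Fin (1 / to_fract u)"
    using u(2) by (simp add: mact_def \<gamma>_def)
  ultimately show ?thesis using cusp_mact[OF n] by metis
qed

section \<open>Comparison of the two sides\<close>

abbreviation pt :: "'k \<Rightarrow> 'k projline \<Rightarrow>\<^sub>0 int" where "pt z \<equiv> frag_of (Fin z)"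

abbreviation const :: "'a::field \<Rightarrow> 'a poly fract" where "const c \<equiv> to_fract [:c:]"

lemma pt_diff_closed: "pt s - pt r \<in> carrier (Div0 UNIV)"
  by (simp add: Div0_closed(6))

text \<open>Scaling by a nonzero constant is the action of a diagonal matrix in
  \<open>Gamma0\<close>.\<close>

lemma null_mod_scale:
  assumes n: "ideal \<nn> polyring" and "c \<noteq> 0"
  shows "(pt (const c * s) - pt (const c * r)) - (pt s - pt r) \<in> null_mod p \<nn>"
proof -
  define \<gamma> where "\<gamma> = mat2 [:c:] 0 0 1"
  have "\<gamma> \<in> Gamma0 \<nn>"
    using n \<open>c \<noteq> 0\<close> by (simp add: \<gamma>_def Gamma0_iff det_2 ideal_polyring_iff is_unit_const_poly_iff dvd_field_iff)
  moreover have "mact \<gamma> (Fin z) = Fin (const c * z)" for z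
    by (simp add: mact_def \<gamma>_def)
  ultimately show ?thesis
    using coinv_null_mod[OF coinv_generator[OF _ pt_diff_closed[of s r]], of \<gamma> \<nn> p]
    by (simp add: div_act_diff)
qed

text \<open>Translation by a polynomial is the action of an upper unipotent matrix in
  \<open>Gamma0\<close>.\<close>

lemma null_mod_translate:
  assumes n: "ideal \<nn> polyring"
  shows "(pt (s + to_fract f) - pt (r + to_fract f)) - (pt s - pt r) \<in> null_mod p \<nn>"
proof -
  define \<gamma> where "\<gamma> = mat2 1 f 0 1"
  have "\<gamma> \<in> Gamma0 \<nn>"
    using n by (simp add: \<gamma>_def Gamma0_iff det_2 ideal_polyring_iff)
  moreover have "mact \<gamma> (Fin z) = Fin (z + to_fract f)" for z
    by (simp add: mact_def \<gamma>_def)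
  ultimately show ?thesis
    using coinv_null_mod[OF coinv_generator[OF _ pt_diff_closed[of s r]], of \<gamma> \<nn> p]
    by (simp add: div_act_diff)
qed

lemma sum_constant_frag_cmul: "finite A \<Longrightarrow> (\<Sum>x\<in>A. D) = frag_cmul (int (card A)) D"
  by (induction A rule: finite_induct) (simp_all add: frag_cmul_distrib add.commute)

lemma sum_constant_null_mod:
  assumes "D \<in> carrier (Div0 UNIV)" "p dvd card A" "finite A"
  shows "(\<Sum>x\<in>A. D) \<in> null_mod p \<nn>"
proof -
  obtain m where m: "card A = p * m" using assms(2) by (elim dvdE)
  \<comment> \<open>The \<open>p * m\<close> equal summands are grouped into \<open>p\<close> blocks
    of \<open>m\<close>.\<close>
  have "(\<Sum>x\<in>A. D) = (\<Sum>i<p. \<Sum>j<m. D)"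
    using assms(3) by (simp add: sum_constant_frag_cmul m)
  then show ?thesis using multiple_null_mod[of "\<Sum>j<m. D"] Div0_closed(5) assms(1) by metis
qed

section \<open>Hecke sets in degree at most one\<close>

lemma monic_degree_0: "monic f \<Longrightarrow> degree f = 0 \<Longrightarrow> f = (1 :: 'a::field poly)"
  by (auto elim: degree_eq_zeroE simp: one_pCons)

lemma Hecke_set_1:
  assumes n: "ideal \<nn> polyring"
  shows "Hecke_set \<nn> (PIdl\<^bsub>polyring\<^esub> 1) = {mat2 1 0 0 1}"
proof (intro Set.set_eqI iffI)
  fix g assume "g \<in> Hecke_set \<nn> (PIdl\<^bsub>polyring\<^esub> 1)"
  then obtain a b d where g: "g = mat2 a b 0 d" "monic a" "monic d" "b = 0 \<or> degree b < degree d"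
      "PIdl\<^bsub>polyring\<^esub> (a * d) = PIdl\<^bsub>polyring\<^esub> 1"
    by (auto simp: Hecke_set_def)
  have "monic (a * d)" using g by (simp add: lead_coeff_mult)
  then have "a * d = 1" using g(5) monic_generator_PIdl by (metis lead_coeff_1)
  moreover have "a \<noteq> 0" "d \<noteq> 0" using g by auto
  ultimately have "degree a = 0" "degree d = 0" by (metis add_is_0 degree_1 degree_mult_eq)+
  then have "a = 1" "d = 1" using monic_degree_0[OF g(2)] monic_degree_0[OF g(3)] by blast+
  with g \<open>degree d = 0\<close> show "g \<in> {mat2 1 0 0 1}" by simp
next
  fix g assume "g \<in> {mat2 1 0 0 (1 :: 'a poly)}"
  then show "g \<in> Hecke_set \<nn> (PIdl\<^bsub>polyring\<^esub> 1)"
    using Hecke_setI[of 1 1 \<nn> 0] coprime_to_1[OF n] by simp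
qed

text \<open>As \<open>a * d = P\<close> is linear, either \<open>d = 1\<close>, which forces
  \<open>b = 0\<close>, or \<open>a = 1\<close>, and then \<open>b\<close> is any constant. The
  first case occurs because \<open>P\<close> is prime to \<nn>.\<close>

lemma Hecke_set_degree_1:
  fixes P :: "'a::field poly"
  assumes n: "ideal \<nn> polyring" and P: "monic P" "degree P = 1" "coprime_to \<nn> P"
  shows "Hecke_set \<nn> (PIdl\<^bsub>polyring\<^esub> P) = insert (mat2 P 0 0 1) (range (\<lambda>c. mat2 1 [:c:] 0 P))"
proof (intro Set.set_eqI iffI)
  fix g assume "g \<in> Hecke_set \<nn> (PIdl\<^bsub>polyring\<^esub> P)"
  then obtain a b d where g: "g = mat2 a b 0 d" "monic a" "monic d" "b = 0 \<or> degree b < degree d"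
      "PIdl\<^bsub>polyring\<^esub> (a * d) = PIdl\<^bsub>polyring\<^esub> P"
    by (auto simp: Hecke_set_def)
  have "monic (a * d)" using g by (simp add: lead_coeff_mult)
  then have ad: "a * d = P" using g(5) monic_generator_PIdl P(1) by metis
  moreover have nz: "a \<noteq> 0" "d \<noteq> 0" using g by auto
  ultimately have "degree a + degree d = 1" using P(2) by (metis degree_mult_eq)
  then consider "degree d = 0" | "degree a = 0" "degree d = 1" by linarith
  then show "g \<in> insert (mat2 P 0 0 1) (range (\<lambda>c. mat2 1 [:c:] 0 P))"
  proof cases
    case 1
    then have "d = 1" by (rule monic_degree_0[OF g(3)])
    with g ad 1 show ?thesis by simp
  next
    case 2
    then have "a = 1" using monic_degree_0[OF g(2)] by blast
    moreover have "degree b = 0" using g 2 by auto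
    then obtain c where "b = [:c:]" by (auto elim: degree_eq_zeroE)
    ultimately show ?thesis using g ad by auto
  qed
next
  fix g assume "g \<in> insert (mat2 P 0 0 1) (range (\<lambda>c. mat2 1 [:c:] 0 P))"
  then show "g \<in> Hecke_set \<nn> (PIdl\<^bsub>polyring\<^esub> P)"
  proof
    assume "g = mat2 P 0 0 1"
    then show ?thesis using Hecke_setI[of P 1 \<nn> 0] P by simp
  next
    assume "g \<in> range (\<lambda>c. mat2 1 [:c:] 0 P)"
    then obtain c where "g = mat2 1 [:c:] 0 P" by blast
    then show ?thesis using Hecke_setI[of 1 P \<nn> "[:c:]"] P coprime_to_1[OF n] by simp
  qed
qed

lemma Hecke_sum_degree_1:
  fixes P :: "'a::{field,finite} poly"
  assumes n: "ideal \<nn> polyring" and P: "monic P" "degree P = 1" "coprime_to \<nn> P"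
  shows "(\<Sum>g\<in>Hecke_set \<nn> (PIdl\<^bsub>polyring\<^esub> P). div_act g (pt z - pt 0)) =
    (pt (to_fract P * z) - pt 0) + (\<Sum>c\<in>UNIV. pt ((z + const c) / to_fract P) - pt (const c / to_fract P))"
proof -
  have P0: "P \<noteq> 0" "P \<noteq> 1" using P by auto
  have inj: "inj (\<lambda>c. mat2 1 [:c:] 0 P)" by (rule injI) (auto simp: mat2_eq_iff)
  have notin: "mat2 P 0 0 1 \<notin> range (\<lambda>c. mat2 1 [:c:] 0 P)" using P0(2) by (auto simp: mat2_eq_iff)
  have "mact (mat2 P 0 0 1) (Fin w) = Fin (to_fract P * w)" for w
    by (simp add: mact_def)
  moreover have "mact (mat2 1 [:c:] 0 P) (Fin w) = Fin ((w + const c) / to_fract P)" for c w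
    using P0 by (simp add: mact_def)
  ultimately show ?thesis
    unfolding Hecke_set_degree_1[OF assms]
    using notin by (simp add: sum.reindex[OF inj] div_act_diff)
qed

text \<open>The four pieces are the part of the Hecke image with \<open>a = 1\<close>, the symbol
  x(P_d u : 1), the symbols x(P_d u : P_c), and the terms [1/P_d, 1/P_c]. The last are kept apart
  because they cancel only after summation over \<open>d\<close>.\<close>

lemma Hecke_symbol_difference:
  fixes u :: "'a::{field,finite} poly" and d :: 'a
  assumes n: "ideal \<nn> polyring" and u: "degree u = 1"
  defines "U \<equiv> to_fract u"
  shows "(\<Sum>b\<in>UNIV. pt ((1 / U + const b) / (U + const d)) - pt (const b / (U + const d)))
    - (pt (1 / (U * (U + const d))) - pt 0)
    - (\<Sum>c\<in>-{0, d}. pt ((const (1 / (d - c)) * U + 1) / (U * (U + const d))) - pt (const (1 / (d - c)) / (U + const c)))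
    - (\<Sum>c\<in>UNIV. pt (1 / (U + const c)) - pt (1 / (U + const d))) \<in> null_mod p \<nn>"
proof -
  have nz: "U + const c \<noteq> 0" for c
  proof -
    have "degree (u + [:c:]) = 1" using u by (simp add: degree_add_eq_left)
    then have "u + [:c:] \<noteq> 0" by auto
    then show ?thesis unfolding U_def by (metis to_fract_add to_fract_eq_0_iff)
  qed
  from nz[of 0] have U0: "U \<noteq> 0" by simp
  define P where "P c = U + const c" for c
  define b where "b c = const (1 / (d - c))" for c
  define Z where "Z c = (b c * U + 1) / (U * P d)" for c
  have P0: "P c \<noteq> 0" for c using nz by (simp add: P_def)
  have b: "b c * (const d - const c) = 1" if "c \<noteq> d" for c
  proof -
    have "[:1 / (d - c):] * ([:d:] - [:c:]) = 1" using that by (simp add: one_pCons)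
    then show ?thesis unfolding b_def by (metis to_fract_1 to_fract_diff to_fract_mult)
  qed
  \<comment> \<open>Replaces the nonzero \<open>b\<close> of the Hecke sum by the
    \<open>c \<noteq> d\<close> with \<open>b = 1/(d - c)\<close>.\<close>
  have bij: "bij_betw (\<lambda>c. 1 / (d - c)) (- {d}) (- {0})"
    by (rule bij_betw_byWitness[where f' = "\<lambda>b. d - 1 / b"]) auto
  have frac: "(1 / U + w) / P d = (w * U + 1) / (U * P d)" for w
    using U0 P0[of d] by (simp add: field_simps)
  \<comment> \<open>The term with \<open>b = 0\<close>, which is split off, is the symbol x(P_d u :
    1).\<close>
  have "(\<Sum>b\<in>UNIV. pt ((1 / U + const b) / P d) - pt (const b / P d)) =
      (pt (1 / (U * P d)) - pt 0) + (\<Sum>b\<in>-{0}. pt ((1 / U + const b) / P d) - pt (const b / P d))"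
    using sum.remove[of UNIV 0 "\<lambda>b. pt ((1 / U + const b) / P d) - pt (const b / P d)"]
    by (simp add: Compl_eq_Diff_UNIV)
  also have "(\<Sum>b\<in>-{0}. pt ((1 / U + const b) / P d) - pt (const b / P d)) =
      (\<Sum>c\<in>-{d}. pt (Z c) - pt (b c / P d))"
    unfolding sum.reindex_bij_betw[OF bij, symmetric] frac Z_def b_def ..
  \<comment> \<open>Inserting the point \<open>b c / P c\<close> separates the Manin-Teitelbaum
    symbol from a difference that can be scaled.\<close>
  also have "(\<Sum>c\<in>-{d}. pt (Z c) - pt (b c / P d)) =
      (\<Sum>c\<in>-{d}. if c = 0 then 0 else pt (Z c) - pt (b c / P c)) +
      (\<Sum>c\<in>-{d}. pt (b c / P c) - pt (b c / P d))"
    unfolding sum.distrib[symmetric]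
  proof (rule sum.cong)
    fix c assume "c \<in> - {d}"
    then have "c \<noteq> d" by simp
    show "pt (Z c) - pt (b c / P d) = (if c = 0 then 0 else pt (Z c) - pt (b c / P c)) +
        (pt (b c / P c) - pt (b c / P d))"
    proof (cases "c = 0")
      case True
      \<comment> \<open>Here \<open>b c * const d = 1\<close>, so \<open>Z c\<close> coincides with
        \<open>b c / P c\<close> and no symbol is left for \<open>c = 0\<close>.\<close>
      have "b c * U + 1 = b c * P d" using b[OF \<open>c \<noteq> d\<close>] True by (simp add: P_def algebra_simps)
      then have "Z c = b c / P c" using U0 P0 True by (simp add: Z_def P_def)
      with True show ?thesis by simp
    qed simp
  qed simp
  also have "(\<Sum>c\<in>-{d}. if c = 0 then 0 else pt (Z c) - pt (b c / P c)) =
      (\<Sum>c\<in>-{0, d}. pt (Z c) - pt (b c / P c))"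
    by (rule sum.mono_neutral_cong_right) auto
  finally have eq: "(\<Sum>b\<in>UNIV. pt ((1 / U + const b) / P d) - pt (const b / P d)) =
      (pt (1 / (U * P d)) - pt 0) + ((\<Sum>c\<in>-{0, d}. pt (Z c) - pt (b c / P c)) +
      (\<Sum>c\<in>-{d}. pt (b c / P c) - pt (b c / P d)))" .
  have "(\<Sum>c\<in>UNIV. pt (1 / P c) - pt (1 / P d)) = (\<Sum>c\<in>-{d}. pt (1 / P c) - pt (1 / P d))"
    by (rule sum.mono_neutral_right) auto
  moreover have "(\<Sum>c\<in>-{d}. (pt (b c / P c) - pt (b c / P d)) - (pt (1 / P c) - pt (1 / P d))) \<in> null_mod p \<nn>"
  proof (rule null_mod_sum)
    fix c assume "c \<in> - {d}"
    then have "1 / (d - c) \<noteq> 0" by simp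
    from null_mod_scale[OF n this, of "1 / P c" "1 / P d"]
    show "(pt (b c / P c) - pt (b c / P d)) - (pt (1 / P c) - pt (1 / P d)) \<in> null_mod p \<nn>"
      by (simp add: b_def)
  qed
  \<comment> \<open>The letters stand for the term with \<open>b = 0\<close>, the sum of symbols,
    and the differences before and after scaling.\<close>
  moreover have "(v + (w + x)) - v - w - y = x - y" for v w x y :: "'a poly fract projline \<Rightarrow>\<^sub>0 int"
    by simp
  ultimately show ?thesis
    unfolding P_def[symmetric] b_def[symmetric] Z_def[symmetric] eq
    by (simp only: sum_subtractf)
qed

text \<open>As (U + d)/U = 1 + d/U, translation and scaling give [0, 1 + d/U] = [0, 1] + [0, 1/U]
  for \<open>d \<noteq> 0\<close>, and only [0, 1] for \<open>d = 0\<close>. The extra symbol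
  [0, 1/U] fills this gap, leaving q equal summands.\<close>

lemma pt_translates_null_mod:
  fixes u :: "'a::{field,finite} poly"
  assumes n: "ideal \<nn> polyring" and u: "degree u = 1" and p: "p dvd CARD('a)"
  defines "U \<equiv> to_fract u"
  shows "(pt (1 / U) - pt 0) + (\<Sum>d\<in>UNIV. pt ((U + const d) * (1 / U)) - pt 0) \<in> null_mod p \<nn>"
proof -
  have U0: "U \<noteq> 0" using u by (auto simp: U_def)
  let ?W = "pt (1 / U) - pt 0"
  let ?V = "pt 1 - pt (0 :: 'a poly fract)"
  let ?T = "\<lambda>d. pt ((U + const d) * (1 / U)) - pt 0 - ?V - (if d = 0 then 0 else ?W)"
  have "?T d \<in> null_mod p \<nn>" for d
  proof (cases "d = 0")
    case True
    then show ?thesis using U0 by (simp add: null_mod_closed)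
  next
    case False
    have "(U + const d) * (1 / U) = const d * (1 / U) + to_fract 1"
      using U0 by (simp add: field_simps)
    \<comment> \<open>The first summand is a translation by 1, the second a scaling by
      \<open>d\<close>; each lies in the kernel.\<close>
    then have "?T d = ((pt (const d * (1 / U) + to_fract 1) - pt (0 + to_fract 1)) - (pt (const d * (1 / U)) - pt 0))
        + ((pt (const d * (1 / U)) - pt (const d * 0)) - ?W)"
      using False by simp
    then show ?thesis
      using null_mod_closed(2)[OF null_mod_translate[OF n] null_mod_scale[OF n False]] by metis
  qed
  then have "(\<Sum>d\<in>UNIV. ?T d) \<in> null_mod p \<nn>" by (rule null_mod_sum)
  moreover have "(\<Sum>d\<in>(UNIV :: 'a set). ?V + ?W) \<in> null_mod p \<nn>"
    by (rule sum_constant_null_mod) (use p in \<open>auto intro: Div0_closed pt_diff_closed\<close>)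
  ultimately have "(\<Sum>d\<in>UNIV. ?T d) + (\<Sum>d\<in>(UNIV :: 'a set). ?V + ?W) \<in> null_mod p \<nn>"
    by (rule null_mod_closed)
  also have "(\<Sum>d\<in>UNIV. ?T d) + (\<Sum>d\<in>(UNIV :: 'a set). ?V + ?W) =
      (\<Sum>d\<in>UNIV. (pt ((U + const d) * (1 / U)) - pt 0) + (if d = 0 then ?W else 0))"
    unfolding sum.distrib[symmetric] by (rule sum.cong) simp_all
  also have "\<dots> = ?W + (\<Sum>d\<in>UNIV. pt ((U + const d) * (1 / U)) - pt 0)"
    by (simp add: sum.distrib)
  finally show ?thesis .
qed

text \<open>Constants parametrise the monic linear polynomials relative to \<open>u\<close>, so that
  \<open>u\<close> itself has index 0.\<close>

lemma monic_degree_1_eq_range: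
  fixes u :: "'a::field poly"
  assumes "monic u" "degree u = 1"
  shows "{f. monic f \<and> degree f = 1} = range (\<lambda>c. u + [:c:])"
proof (intro Set.set_eqI iffI)
  fix f :: "'a poly" assume f: "f \<in> {f. monic f \<and> degree f = 1}"
  obtain a b where "u = [:b, a:]" using degree1_coeffs[OF assms(2)] by metis
  moreover obtain a' b' where "f = [:b', a':]" using f degree1_coeffs by blast
  ultimately have "f = u + [:b' - b:]" using f assms by (auto split: if_splits)
  then show "f \<in> range (\<lambda>c. u + [:c:])" by blast
next
  fix f assume "f \<in> range (\<lambda>c. u + [:c:])"
  then show "f \<in> {f. monic f \<and> degree f = 1}"
    using assms by (auto simp: degree_add_eq_left coeff_eq_0)
qed

theorem proposition6p1:
  fixes p q k :: nat
    and \<nn> :: "'a::{field,finite} poly set"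
    and u :: "'a poly"
  assumes "prime p" and "q = p ^ k" and "CARD('a) = q"
    and "nonzero_ideal \<nn>"
    and "\<nexists>\<qq>. prime_factor \<qq> \<nn> \<and> ideal_degree \<qq> = 1"
    and "monic u" and "degree u = 1"
  shows "cuspidal_mod p \<nn> (MT_symbol_mod p \<nn> u 1) \<and>
    (\<Otimes>\<^bsub>mod_p p (MS \<nn>)\<^esub>\<pp>\<in>{\<pp>. nonzero_ideal \<pp> \<and> ideal_degree \<pp> \<le> 1}.
        Hecke_mod p \<nn> \<pp> (MT_symbol_mod p \<nn> u 1)) =
    (\<Otimes>\<^bsub>mod_p p (MS \<nn>)\<^esub>\<pp>\<in>{\<pp>. nonzero_ideal \<pp> \<and> ideal_degree \<pp> = 1}.
        \<Otimes>\<^bsub>mod_p p (MS \<nn>)\<^esub>v\<in>{v. monic v \<and> degree v \<le> 1 \<and> v \<noteq> u \<and> v \<noteq> monic_generator \<pp>}.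
          MT_symbol_mod p \<nn> (monic_generator \<pp> * u) v)"
proof -
  have n: "ideal \<nn> polyring" using assms(4) by (simp add: nonzero_ideal_def)
  define U where "U = to_fract u"
  define P where "P d = u + [:d:]" for d
  have rangeP: "{f. monic f \<and> degree f = 1} = range P"
    unfolding P_def by (rule monic_degree_1_eq_range[OF assms(6,7)])
  have P: "monic (P d)" "degree (P d) = 1" for d
  proof -
    have "P d \<in> {f. monic f \<and> degree f = 1}" unfolding rangeP by blast
    then show "monic (P d)" "degree (P d) = 1" by blast+
  qed
  then have P_nz: "P d \<noteq> 0" "P d \<noteq> 1" for d by (metis degree_0 degree_1 zero_neq_one)+
  have inj_P: "inj P" by (rule injI) (simp add: P_def)
  have cop: "coprime_to \<nn> (P d)" for d by (rule coprime_to_degree_1[OF n assms(5) P])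
  have toP: "to_fract (P d) = U + const d" for d by (simp add: P_def U_def)
  have U_nz: "U + const c \<noteq> 0" for c using P_nz(1)[of c] by (simp flip: toP)
  have u: "u = P 0" "u \<noteq> 0" using assms(7) by (auto simp: P_def)
  have U0: "U \<noteq> 0" using u by (simp add: U_def)
  \<comment> \<open>The field contains 0 and 1, so \<open>q \<ge> 2\<close>. This excludes
    \<open>k = 0\<close>, and \<open>p\<close> divides \<open>q\<close>.\<close>
  have "card {0, 1 :: 'a} \<le> CARD('a)" by (rule card_mono) auto
  then have "CARD('a) \<ge> 2" by simp
  then have "k \<noteq> 0" using assms(2,3) by (intro notI) simp
  then have p: "p dvd CARD('a)" using assms(2,3) by (simp add: dvd_power)
  interpret Q: comm_group "mod_p p (MS \<nn>)" by (simp add: comm_group_mod_p)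
  have symbol_closed: "symbol_mod p \<nn> D \<in> carrier (mod_p p (MS \<nn>))" if "D \<in> carrier (Div0 UNIV)" for D
    using symbol_mod_hom that by (auto simp: hom_def)

  define D0 where "D0 = pt (1 / U) - pt 0"
  have D0: "D0 \<in> carrier (Div0 UNIV)" unfolding D0_def by (rule pt_diff_closed)
  \<comment> \<open>The completion with top row \<open>(1, 0)\<close> fixes 0 and sends \<infinity>
    to \<open>1/U\<close>.\<close>
  have MT_u: "MT_symbol_mod p \<nn> u 1 = symbol_mod p \<nn> D0"
    using MT_symbol_mod_eq[OF n, of 1 0 u 1] u(2) by (simp add: det_2 mact_def D0_def U_def)
  \<comment> \<open>Both endpoints are the same cusp, so the boundary vanishes already over the
    integers.\<close>
  have "boundary_div \<nn> D0 = 0"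
    using cusp_unit_fraction[OF n _ u(2)] cop[of 0] u(1)
    by (simp add: boundary_div_def D0_def U_def frag_extend_diff)
  then have cuspidal: "cuspidal_mod p \<nn> (MT_symbol_mod p \<nn> u 1)"
    unfolding MT_u by (rule cuspidal_mod_symbol_mod[OF n D0])

  have le_1: "{f :: 'a poly. monic f \<and> degree f \<le> 1} = insert 1 (range P)"
    unfolding rangeP[symmetric] using monic_degree_0 by (auto simp: le_Suc_eq)
  let ?J = "\<lambda>d. PIdl\<^bsub>polyring\<^esub> (P d)"
  have inj_J: "inj ?J"
    using P(1) inj_P by (intro injI) (metis monic_generator_PIdl injD)
  have ideals_le_1: "{\<pp> :: 'a poly set. nonzero_ideal \<pp> \<and> ideal_degree \<pp> \<le> 1} = insert (PIdl\<^bsub>polyring\<^esub> 1) (range ?J)"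
    using nonzero_ideals_eq_image[where 'a='a and Q="\<lambda>m. m \<le> 1"] unfolding le_1 by (simp only: image_insert image_image)
  have ideals_1: "{\<pp> :: 'a poly set. nonzero_ideal \<pp> \<and> ideal_degree \<pp> = 1} = range ?J"
    using nonzero_ideals_eq_image[where 'a='a and Q="\<lambda>m. m = 1"] unfolding rangeP by (simp only: image_image)
  \<comment> \<open>The unit ideal is a separate index; its Hecke set is the identity matrix alone
    and contributes the summand \<open>D0\<close> of \<open>L\<close>.\<close>
  have J1: "PIdl\<^bsub>polyring\<^esub> 1 \<notin> range ?J"
    using P(1) P_nz(2) by (metis (no_types, lifting) imageE lead_coeff_1 monic_generator_PIdl)

  define S where "S d = (\<Sum>b\<in>UNIV. pt ((1 / U + const b) / (U + const d)) - pt (const b / (U + const d)))" for d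
  define L where "L = D0 + (\<Sum>d\<in>UNIV. (pt ((U + const d) * (1 / U)) - pt 0) + S d)"
  have Hecke_1: "(\<Sum>g\<in>Hecke_set \<nn> (PIdl\<^bsub>polyring\<^esub> 1). div_act g D0) = D0"
    by (simp add: Hecke_set_1[OF n] D0_def div_act_diff mact_def)
  have Hecke_P: "(\<Sum>g\<in>Hecke_set \<nn> (?J d). div_act g D0) = (pt ((U + const d) * (1 / U)) - pt 0) + S d" for d
    unfolding D0_def Hecke_sum_degree_1[OF n P cop] toP S_def ..
  have "(\<Otimes>\<^bsub>mod_p p (MS \<nn>)\<^esub>\<pp>\<in>{\<pp>. nonzero_ideal \<pp> \<and> ideal_degree \<pp> \<le> 1}.
        Hecke_mod p \<nn> \<pp> (MT_symbol_mod p \<nn> u 1)) =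
      symbol_mod p \<nn> (\<Sum>\<pp>\<in>insert (PIdl\<^bsub>polyring\<^esub> 1) (range ?J). \<Sum>g\<in>Hecke_set \<nn> \<pp>. div_act g D0)"
    unfolding MT_u Hecke_mod_symbol_mod[OF n D0] ideals_le_1
    by (rule finprod_symbol_mod) (auto intro: Div0_closed div_act_closed D0)
  also have "(\<Sum>\<pp>\<in>insert (PIdl\<^bsub>polyring\<^esub> 1) (range ?J). \<Sum>g\<in>Hecke_set \<nn> \<pp>. div_act g D0) = L"
    using J1 by (simp add: sum.reindex[OF inj_J] Hecke_1 Hecke_P L_def)
  finally have lhs: "(\<Otimes>\<^bsub>mod_p p (MS \<nn>)\<^esub>\<pp>\<in>{\<pp>. nonzero_ideal \<pp> \<and> ideal_degree \<pp> \<le> 1}.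
        Hecke_mod p \<nn> \<pp> (MT_symbol_mod p \<nn> u 1)) = symbol_mod p \<nn> L" .

  define M1 where "M1 d = pt (1 / (U * (U + const d))) - pt 0" for d
  define M where "M d c = pt ((const (1 / (d - c)) * U + 1) / (U * (U + const d))) -
      pt (const (1 / (d - c)) / (U + const c))" for d c
  \<comment> \<open>The inner product runs over polynomials \<open>v\<close>, so \<open>c\<close> is
    recovered as the constant coefficient of \<open>v - u\<close>; \<open>v = 1\<close> is the case
    of degree 0.\<close>
  define R where "R d v = (if v = 1 then M1 d else M d (coeff (v - u) 0))" for d v
  have R_closed: "R d v \<in> carrier (Div0 UNIV)" for d v
    by (simp add: R_def M1_def M_def pt_diff_closed)
  have R_1: "R d 1 = M1 d" for d by (simp add: R_def)
  have R_P: "R d (P c) = M d c" for c d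
  proof -
    have "P c - u = [:c:]" by (simp add: P_def)
    then show ?thesis using P_nz(2) by (simp add: R_def)
  qed
  have MT_1: "MT_symbol_mod p \<nn> (P d * u) 1 = symbol_mod p \<nn> (M1 d)" for d
    using MT_symbol_mod_eq[OF n, of 1 0 "P d * u" 1] U0 U_nz
    by (simp add: det_2 mact_def M1_def toP U_def[symmetric] mult.commute)
  have MT_P: "MT_symbol_mod p \<nn> (P d * u) (P c) = symbol_mod p \<nn> (M d c)" if "c \<noteq> 0" "c \<noteq> d" for c d
  proof -
    \<comment> \<open>With this \<open>b\<close>, the multiple of \<open>u\<close> in the
      determinant of the matrix with rows \<open>(b u + 1, b)\<close> and
      \<open>(P d * u, P c)\<close> cancels. What remains is the constant \<open>c\<close>, a unit
      since \<open>c \<noteq> 0\<close>.\<close>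
    define b where "b = 1 / (d - c)"
    have "[:b:] * ([:d:] - [:c:]) = 1" using that by (simp add: b_def one_pCons)
    moreover have "(x * u + 1) * (u + y) - x * ((u + z) * u) = y + u * (1 - x * (z - y))"
      for x y z :: "'a poly" by (simp add: algebra_simps)
    ultimately have "([:b:] * u + 1) * P c - [:b:] * (P d * u) = [:c:]"
      unfolding P_def by (simp only: diff_self mult_zero_right add_0_right)
    then have "det (mat2 ([:b:] * u + 1) [:b:] (P d * u) (P c)) dvd 1"
      using that by (simp add: det_2 is_unit_const_poly_iff dvd_field_iff)
    moreover have "to_fract (smult b u) = const b * U"
      using to_fract_mult[of "[:b:]" u] by (simp add: U_def)
    ultimately show ?thesis
      using U0 U_nz MT_symbol_mod_eq[OF n, of "[:b:] * u + 1" "[:b:]" "P d * u" "P c" p]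
      by (simp add: mact_def M_def toP U_def[symmetric] b_def[symmetric] mult.commute)
  qed
  \<comment> \<open>As \<open>u = P 0\<close>, the two exclusions remove the indices 0 and
    \<open>d\<close>.\<close>
  have V: "{v. monic v \<and> degree v \<le> 1 \<and> v \<noteq> u \<and> v \<noteq> P d} = insert 1 (P ` (- {0, d}))" for d
  proof -
    have "{v. monic v \<and> degree v \<le> 1 \<and> v \<noteq> u \<and> v \<noteq> P d} = insert 1 (range P) - {P 0, P d}"
      using le_1 u(1) by auto
    also have "\<dots> = insert 1 (P ` (- {0, d}))"
      using P_nz(2) inj_P by (auto simp: inj_eq)
    finally show ?thesis .
  qed
  have inner: "(\<Otimes>\<^bsub>mod_p p (MS \<nn>)\<^esub>v\<in>{v. monic v \<and> degree v \<le> 1 \<and> v \<noteq> u \<and> v \<noteq> monic_generator (?J d)}.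
        MT_symbol_mod p \<nn> (monic_generator (?J d) * u) v) = symbol_mod p \<nn> (M1 d + (\<Sum>c\<in>-{0, d}. M d c))" for d
  proof -
    have "(\<Otimes>\<^bsub>mod_p p (MS \<nn>)\<^esub>v\<in>insert 1 (P ` (- {0, d})). MT_symbol_mod p \<nn> (P d * u) v) =
        (\<Otimes>\<^bsub>mod_p p (MS \<nn>)\<^esub>v\<in>insert 1 (P ` (- {0, d})). symbol_mod p \<nn> (R d v))"
    proof (rule Q.finprod_cong')
      fix v assume "v \<in> insert 1 (P ` (- {0, d}))"
      then consider "v = 1" | c where "c \<noteq> 0" "c \<noteq> d" "v = P c" by blast
      then show "MT_symbol_mod p \<nn> (P d * u) v = symbol_mod p \<nn> (R d v)"
        by cases (simp_all add: R_1 R_P MT_1 MT_P)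
    qed (auto intro: symbol_closed R_closed)
    also have "\<dots> = symbol_mod p \<nn> (\<Sum>v\<in>insert 1 (P ` (- {0, d})). R d v)"
      by (rule finprod_symbol_mod) (auto intro: R_closed)
    also have "(\<Sum>v\<in>insert 1 (P ` (- {0, d})). R d v) = M1 d + (\<Sum>c\<in>-{0, d}. R d (P c))"
      using P_nz(2) sum.reindex[OF inj_on_subset[OF inj_P subset_UNIV, of "- {0, d}"], where g = "R d"]
      by (subst sum.insert) (auto simp: R_1)
    finally show ?thesis unfolding monic_generator_PIdl[OF P(1)] V R_P .
  qed
  have M_closed: "symbol_mod p \<nn> (M1 d + (\<Sum>c\<in>-{0, d}. M d c)) \<in> carrier (mod_p p (MS \<nn>))" for d
    by (auto simp: M1_def M_def intro!: symbol_closed Div0_closed pt_diff_closed)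
  have "(\<Otimes>\<^bsub>mod_p p (MS \<nn>)\<^esub>\<pp>\<in>{\<pp>. nonzero_ideal \<pp> \<and> ideal_degree \<pp> = 1}.
        \<Otimes>\<^bsub>mod_p p (MS \<nn>)\<^esub>v\<in>{v. monic v \<and> degree v \<le> 1 \<and> v \<noteq> u \<and> v \<noteq> monic_generator \<pp>}.
          MT_symbol_mod p \<nn> (monic_generator \<pp> * u) v) =
      (\<Otimes>\<^bsub>mod_p p (MS \<nn>)\<^esub>d\<in>UNIV. symbol_mod p \<nn> (M1 d + (\<Sum>c\<in>-{0, d}. M d c)))"
    unfolding ideals_1 inner[symmetric]
    by (rule Q.finprod_reindex[OF _ inj_J], rule funcsetI, elim imageE) (simp only: inner M_closed)
  also have "\<dots> = symbol_mod p \<nn> (\<Sum>d\<in>UNIV. M1 d + (\<Sum>c\<in>-{0, d}. M d c))"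
    by (rule finprod_symbol_mod) (auto simp: M1_def M_def intro!: Div0_closed pt_diff_closed)
  also have "\<dots> = symbol_mod p \<nn> L"
  proof (rule symbol_mod_cong[symmetric])
    show "L \<in> carrier (Div0 UNIV)"
      by (auto simp: L_def S_def intro!: Div0_closed pt_diff_closed D0)
    \<comment> \<open>The leftover terms are antisymmetric in \<open>c\<close> and \<open>d\<close>,
      so their double sum is zero. Subtracting it brings each summand into the form of
      \<open>Hecke_symbol_difference\<close>.\<close>
    let ?Y = "\<lambda>d. \<Sum>c\<in>UNIV. pt (1 / (U + const c)) - pt (1 / (U + const d))"
    have "(\<Sum>d\<in>UNIV. ?Y d) = 0"
      unfolding sum_subtractf
      using sum.swap[of "\<lambda>d c. pt (1 / (U + const c))" UNIV UNIV] by simp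
    then have "L - (\<Sum>d\<in>UNIV. M1 d + (\<Sum>c\<in>-{0, d}. M d c)) =
       ((pt (1 / U) - pt 0) + (\<Sum>d\<in>UNIV. pt ((U + const d) * (1 / U)) - pt 0)) +
       (\<Sum>d\<in>UNIV. S d - M1 d - (\<Sum>c\<in>-{0, d}. M d c) - ?Y d)"
      unfolding L_def D0_def sum.distrib sum_subtractf by (simp add: algebra_simps)
    also have "\<dots> \<in> null_mod p \<nn>"
      unfolding S_def M1_def M_def U_def
      by (intro null_mod_closed(2) null_mod_sum pt_translates_null_mod[OF n assms(7) p]
          Hecke_symbol_difference[OF n assms(7)])
    finally show "L - (\<Sum>d\<in>UNIV. M1 d + (\<Sum>c\<in>-{0, d}. M d c)) \<in> null_mod p \<nn>" .
  qed
  finally show ?thesis using cuspidal lhs by simp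
qed

end
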